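(* Let $k,c\ge 2$ and $1\le s\le c-1$ be fixed, let $t=\lceil sk/c\rceil$ and let $\lambda\in[c]$ satisfy $\lambda\equiv sk\pmod c$. Then \[f_{c,s}(n,k)\ge(1-o(1))\frac{\binom{n}{t}}{\binom{k}{t}-m(k,t,\lambda;s+1,c-s+1)},\] where $o(1)\to0$ as $n\to\infty$.
   Context: $[m]=\{1,\dots,m\}$; $\binom{X}{k}$ is the family of $k$-subsets of $X$. A hypergraph $\mathcal{F}\subseteq 2^{[n]}$ is $(c,s)$-frameproof if for every $c+1$ edges $A_0,A_1,\dots,A_c\in\mathcal{F}$ with $A_0\neq A_j$ for each $j\in[c]$ ($A_1,\dots,A_c$ not necessarily distinct), there is some $i\in A_0$ with $|\{j\in[c]:i\in A_j\}|<s$. $f_{c,s}(n,k)$ is the maximum size of a $(c,s)$-frameproof $\mathcal{F}\subseteq\binom{[n]}{k}$. A sequence $A_1,\dots,A_\lambda$ of subsets of $[k]$ (repetitions allowed) is $(k_1,k_2)$-disjoint if $\bigcap_{i\in B}A_i=\emptyset$ for every $k_1$-subset $B\subseteq[\lambda]$ and $\bigcup_{i\in B}A_i=[k]$ for every $k_2$-subset $B\subseteq[\lambda]$ (each condition vacuous if the subset size exceeds $\lambda$). $m(k,t,\lambda;k_1,k_2)$ is the maximum size of $\mathcal{F}\subseteq\binom{[k]}{t}$ containing no $A_1,\dots,A_\lambda\in\mathcal{F}$ (not necessarily distinct) forming a $(k_1,k_2)$-disjoint sequence. *)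

theory Defs
  imports Complex_Main "HOL-Library.Ramsey" "HOL-Number_Theory.Cong"
begin

text \<open>
  The ground set $[n]$ is \<open>{1..n}\<close>, and \<open>nsets X k\<close> is the family of \<open>k\<close>-subsets of \<open>X\<close>.
  A sequence indexed by $[m]$ is a function on \<open>nat\<close> of which only the values on \<open>{1..m}\<close> matter.
\<close>

definition frameproof :: "nat \<Rightarrow> nat \<Rightarrow> nat set set \<Rightarrow> bool" where
  "frameproof c s F \<longleftrightarrow>
     (\<forall>A0\<in>F. \<forall>A :: nat \<Rightarrow> nat set.
        (\<forall>j\<in>{1..c}. A j \<in> F \<and> A0 \<noteq> A j) \<longrightarrow>
        (\<exists>i\<in>A0. card {j \<in> {1..c}. i \<in> A j} < s))"

definition max_frameproof :: "nat \<Rightarrow> nat \<Rightarrow> nat \<Rightarrow> nat \<Rightarrow> nat" where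
  "max_frameproof c s n k = Max {card F | F. F \<subseteq> nsets {1..n} k \<and> frameproof c s F}"

text \<open>
  For \<open>k1 = 0\<close> the empty intersection would be \<open>UNIV\<close> rather than the ground set; either way the
  intersection condition then fails whenever \<open>k > 0\<close>.
\<close>

definition disjoint_seq :: "nat \<Rightarrow> nat \<Rightarrow> nat \<Rightarrow> nat \<Rightarrow> (nat \<Rightarrow> nat set) \<Rightarrow> bool" where
  "disjoint_seq k l k1 k2 A \<longleftrightarrow>
     (\<forall>i\<in>{1..l}. A i \<subseteq> {1..k}) \<and>
     (\<forall>B \<in> nsets {1..l} k1. (\<Inter>i\<in>B. A i) = {}) \<and>
     (\<forall>B \<in> nsets {1..l} k2. (\<Union>i\<in>B. A i) = {1..k})"

text \<open>
  For \<open>l \<ge> 1\<close> the empty family contains no sequence of length \<open>l\<close>, so the maximum is over a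
  nonempty finite set; for \<open>l = 0\<close> the empty sequence is disjoint and the value is unspecified.
\<close>

definition max_disjoint_free :: "nat \<Rightarrow> nat \<Rightarrow> nat \<Rightarrow> nat \<Rightarrow> nat \<Rightarrow> nat" where
  "max_disjoint_free k t l k1 k2 =
     Max {card F | F. F \<subseteq> nsets {1..k} t \<and>
       \<not> (\<exists>A. (\<forall>i\<in>{1..l}. A i \<in> F) \<and> disjoint_seq k l k1 k2 A)}"

end

theory Submission
  imports Defs "HOL-Computational_Algebra.Polynomial" "HOL-Library.FuncSet"
begin

text \<open>
  Let \<open>F\<close> be an extremal family without disjoint sequences and let \<open>G\<close> consist of the remaining
  \<open>t\<close>-subsets of $[k]$. Suppose that the edges are $k$-sets, each carrying a copy of \<open>G\<close>, such that
  two edges meet in at most \<open>t\<close> points and the copy of a member of \<open>G\<close> in one edge lies in no other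
  edge. If $A_0$ is covered at least \<open>s\<close> times by $A_1,\dots,A_c$, thin the traces on $A_0$ out until
  every point is covered exactly \<open>s\<close> times. As $sk = (t-1)c + \lambda$, at least $\lambda$ of the traces
  still have size \<open>t\<close>; they lie in the copy of \<open>F\<close> and form an $(s+1,c-s+1)$-disjoint sequence, a
  contradiction.

  Packings with $(1-o(1))\binom{n}{t}/|G|$ edges have an explicit algebraic construction, which avoids
  the Roedl nibble. Fix a large \<open>v\<close>. The points are pairs of some $x \in [v]$ and a vector over
  $\mathbb{Z}_Q$ with a coordinate for every \<open>t\<close>-set and several for every $(t+1)$-set in $[v]$;
  here \<open>Q\<close> is congruent to 1 modulo a fixed \<open>L\<close>, so that finitely many prescribed nonzero integers are
  units modulo \<open>Q\<close>. Use every injection of $[k]$ into $[v]$ about $Q/m$ times, where each \<open>t\<close>-set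
  lies in \<open>m\<close> of the resulting copies of \<open>G\<close>. An injection with image \<open>V\<close> is lifted by
  polynomials $f_c$ of degree at most \<open>t\<close>, one per coordinate, whose leading coefficients vanish for
  coordinates not inside \<open>V\<close> and add up to zero. For every coordinate inside \<open>V\<close> one weighted sum
  of values of $f_c$ is prescribed; this label identifies the (repeated) injection from any \<open>t\<close>-set in its copy of
  \<open>G\<close> and from any $(t+1)$-set. If two codewords with the same labels agree on a \<open>t\<close>-set \<open>T\<close>, their
  difference is $z_c \prod_{y\in T}(x-y)$ in coordinate \<open>c\<close>. The labels force $z_c = 0$ for all \<open>c\<close>
  other than \<open>T\<close>, and then $z_T = 0$ because the leading coefficients add up to zero. So a code has
  $Q^{td-1}$ words, where \<open>d\<close> is the number of coordinates, which is the optimal number.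
\<close>

section \<open>Polynomials and units modulo \<open>Q\<close>\<close>

text \<open>\<open>Q\<close> need not be prime, so unit differences replace the field axioms: after
  a root \<open>y\<close> is divided off, the factor \<open>x - y\<close> cancels and the quotient
  still vanishes modulo \<open>Q\<close> on the rest of \<open>T\<close>.\<close>

lemma poly_vanishing_mod:
  fixes f :: "int poly" and T :: "int set"
  assumes "finite T" and "degree f \<le> card T"
    and "\<And>x y. x \<in> T \<Longrightarrow> y \<in> T \<Longrightarrow> x \<noteq> y \<Longrightarrow> coprime (x - y) Q"
    and "\<And>y. y \<in> T \<Longrightarrow> Q dvd poly f y"
  shows "\<exists>h. f = smult (coeff f (card T)) (\<Prod>y\<in>T. [:- y, 1:]) + smult Q h"
  using assms
proof (induction T arbitrary: f rule: finite_induct)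
  case empty
  then obtain a where "f = [:a:]" by (auto elim: degree_eq_zeroE)
  then show ?case by (intro exI[of _ 0]) (simp flip: monom_0)
next
  case (insert y T)
  define g where "g = synthetic_div f y"
  have f: "f = [:- y, 1:] * g + [:poly f y:]"
    unfolding g_def by (rule synthetic_div_correct'[symmetric])
  have degg: "degree g \<le> card T"
    using insert by (simp add: g_def degree_synthetic_div)
  have dy: "Q dvd poly f y" using insert.prems by simp
  have "Q dvd poly g x" if x: "x \<in> T" for x
  proof -
    have "poly f x = (x - y) * poly g x + poly f y"
      by (subst f) (simp add: algebra_simps)
    then have "Q dvd (x - y) * poly g x"
      using insert.prems(3)[of x] dy x by (metis dvd_add_left_iff insertCI)
    moreover have "coprime (x - y) Q"
      using insert.prems(2)[of x y] x insert.hyps by auto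
    ultimately show ?thesis
      by (metis coprime_commute coprime_dvd_mult_right_iff)
  qed
  then obtain h where h: "g = smult (coeff g (card T)) (\<Prod>y\<in>T. [:- y, 1:]) + smult Q h"
    using insert.IH[of g] degg insert.prems by blast
  have "coeff g (Suc (card T)) = 0"
    using degg by (simp add: coeff_eq_0)
  then have c: "coeff f (card (insert y T)) = coeff g (card T)"
    using insert.hyps by (subst f) simp
  obtain r where r: "poly f y = Q * r" using dy by blast
  have "f = [:- y, 1:] * (smult (coeff g (card T)) (\<Prod>y\<in>T. [:- y, 1:]) + smult Q h) + [:Q * r:]"
    using f h r by simp
  also have "\<dots> = smult (coeff g (card T)) ([:- y, 1:] * (\<Prod>y\<in>T. [:- y, 1:]))
      + smult Q ([:- y, 1:] * h + [:r:])"
    by (simp add: algebra_simps smult_add_right mult_smult_right smult_diff_right)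
  finally show ?case using insert.hyps c by auto
qed

text \<open>With \<open>L\<close> the absolute value of the product of \<open>Z\<close>, a common
  divisor of \<open>z\<close> and \<open>1 + L * j\<close> divides \<open>L * j\<close>, hence
  1.\<close>

lemma finite_coprime_modulus:
  fixes Z :: "int set"
  assumes "finite Z" "0 \<notin> Z"
  obtains L :: nat where "L > 0" "\<And>j z. z \<in> Z \<Longrightarrow> coprime z (int (1 + L * j))"
proof
  let ?P = "\<Prod>z\<in>Z. z"
  show "nat \<bar>?P\<bar> > 0" using assms by auto
  fix j z assume z: "z \<in> Z"
  then have "z dvd ?P" using dvd_prodI[OF assms(1), of z "\<lambda>z. z"] by simp
  then have "z dvd \<bar>?P\<bar> * int j" by simp
  then have "coprime z (1 + \<bar>?P\<bar> * int j)"
    by (intro coprimeI) (meson dvd_add_left_iff dvd_trans)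
  then show "coprime z (int (1 + nat \<bar>?P\<bar> * j))" by simp
qed

text \<open>These sums are the label forms evaluated at the vanishing polynomial of
  \<open>T\<close>. Once nonzero, they can be made units modulo a suitable \<open>Q\<close>; empty
  \<open>T\<close> covers the plain sums of weights.\<close>

lemma separating_weights:
  obtains \<beta> :: "nat \<Rightarrow> int" where
    "\<And>X T. X \<subseteq> {1..v} \<Longrightarrow> T \<subseteq> {1..v} \<Longrightarrow> \<not> X \<subseteq> T \<Longrightarrow>
       (\<Sum>x\<in>X. \<beta> x * (\<Prod>y\<in>T. int x - int y)) \<noteq> 0"
proof -
  define p where "p T x = (\<Prod>y\<in>T. int x - int y)" for T and x :: nat
  \<comment> \<open>With weights $N^x$ the least element of \<open>X - T\<close> decides the sum modulo a power of \<open>N\<close>.\<close>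
  define N where "N = 1 + (\<Sum>T\<in>Pow {1..v}. \<Sum>x\<in>{1..v}. \<bar>p T x\<bar>)"
  have bd: "\<bar>p T x\<bar> < N" if "T \<subseteq> {1..v}" "x \<in> {1..v}" for T x
  proof -
    have "\<bar>p T x\<bar> \<le> (\<Sum>x\<in>{1..v}. \<bar>p T x\<bar>)"
      using that by (intro member_le_sum) auto
    also have "\<dots> \<le> (\<Sum>T\<in>Pow {1..v}. \<Sum>x\<in>{1..v}. \<bar>p T x\<bar>)"
      using that by (intro member_le_sum[where f = "\<lambda>T. \<Sum>x\<in>{1..v}. \<bar>p T x\<bar>"]) (auto intro: sum_nonneg)
    finally show ?thesis by (simp add: N_def)
  qed
  have "(\<Sum>x\<in>X. N ^ x * p T x) \<noteq> 0"
    if X: "X \<subseteq> {1..v}" and T: "T \<subseteq> {1..v}" and XT: "\<not> X \<subseteq> T" for X T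
  proof
    assume zero: "(\<Sum>x\<in>X. N ^ x * p T x) = 0"
    have fin: "finite X" "finite T" using X T by (auto intro: finite_subset)
    define m where "m = Min (X - T)"
    have m: "m \<in> X - T" unfolding m_def using fin XT by (intro Min_in) auto
    have "N ^ Suc m dvd (\<Sum>x\<in>X - {m}. N ^ x * p T x)"
    proof (rule dvd_sum)
      fix x assume x: "x \<in> X - {m}"
      show "N ^ Suc m dvd N ^ x * p T x"
      proof (cases "x \<in> T")
        case True
        then have "p T x = 0" using fin by (auto simp: p_def)
        then show ?thesis by simp
      next
        case False
        then have "m \<le> x" unfolding m_def using x fin by (intro Min_le) auto
        then have "Suc m \<le> x" using x by auto
        then show ?thesis using le_imp_power_dvd dvd_mult2 by blast
      qed
    qed
    moreover have "(\<Sum>x\<in>X. N ^ x * p T x) = N ^ m * p T m + (\<Sum>x\<in>X - {m}. N ^ x * p T x)"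
      using fin m by (intro sum.remove) auto
    ultimately have "N ^ Suc m dvd N ^ m * p T m"
      using zero by (metis dvd_0_right dvd_add_left_iff)
    moreover have "N > 0" using bd[OF T, of m] m X by auto
    ultimately have "N dvd p T m" by (simp add: mult.commute)
    moreover have "p T m \<noteq> 0" using fin m by (auto simp: p_def)
    ultimately have "N \<le> \<bar>p T m\<bar>" by (intro zdvd_imp_le) auto
    then show False using bd[OF T, of m] m X by auto
  qed
  then show ?thesis unfolding p_def by (rule that)
qed

section \<open>Codes with prescribed labels\<close>

definition coord_val :: "nat \<Rightarrow> ('c \<times> nat \<Rightarrow> int) \<Rightarrow> 'c \<Rightarrow> nat \<Rightarrow> int" where
  "coord_val t a c x = (\<Sum>j\<le>t. a (c, j) * int x ^ j)"

text \<open>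
  A coordinate is a pair of a set and an index, \<open>a (c, j)\<close> is the coefficient of $x^j$ in coordinate \<open>c\<close>.
\<close>

definition labelled_code :: "nat \<Rightarrow> nat \<Rightarrow> (nat set \<times> nat) set \<Rightarrow> (nat \<Rightarrow> int) \<Rightarrow> nat set \<Rightarrow>
    (nat set \<times> nat \<Rightarrow> int) \<Rightarrow> ((nat set \<times> nat) \<times> nat \<Rightarrow> int) set" where
  "labelled_code Q t C \<beta> V lab = {a \<in> C \<times> {..t} \<rightarrow>\<^sub>E {0..<int Q}.
     (\<forall>c\<in>C. \<not> fst c \<subseteq> V \<longrightarrow> a (c, t) = 0) \<and>
     int Q dvd (\<Sum>c\<in>{c \<in> C. fst c \<subseteq> V}. a (c, t)) \<and>
     (\<forall>c\<in>C. fst c \<subseteq> V \<longrightarrow> int Q dvd (\<Sum>x\<in>fst c. \<beta> x * coord_val t a c x) - lab c)}"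

text \<open>At \<open>(T, 0)\<close> the label form annihilates the vanishing polynomial of
  \<open>T\<close>, so the label says nothing about the leading coefficient there. The zero sum of
  leading coefficients settles it, which is why \<open>single\<close> grants \<open>T\<close> only
  one coordinate.\<close>

lemma labelled_code_eqI:
  assumes a: "a \<in> labelled_code Q t C \<beta> V lab" and a': "a' \<in> labelled_code Q t C \<beta> V lab"
    and "finite C" and T: "finite T" "card T = t" "T \<subseteq> V"
    and single: "{c \<in> C. fst c = T} = {(T, 0)}"
    and diff: "\<And>x y. x \<in> T \<Longrightarrow> y \<in> T \<Longrightarrow> x \<noteq> y \<Longrightarrow> coprime (int x - int y) (int Q)"
    and unit: "\<And>c. c \<in> C \<Longrightarrow> fst c \<noteq> T \<Longrightarrow>
       coprime (\<Sum>x\<in>fst c. \<beta> x * (\<Prod>y\<in>T. int x - int y)) (int Q)"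
    and agree: "\<And>c x. c \<in> C \<Longrightarrow> x \<in> T \<Longrightarrow> int Q dvd coord_val t a c x - coord_val t a' c x"
  shows "a = a'"
proof -
  define q where "q = int Q"
  define b where "b c j = a (c, j) - a' (c, j)" for c j
  define f where "f c = (\<Sum>j\<le>t. monom (b c j) j)" for c
  have coeff_f: "coeff (f c) j = (if j \<le> t then b c j else 0)" for c j
    by (simp add: f_def coeff_sum)
  have deg: "degree (f c) \<le> t" for c by (rule degree_le) (simp add: coeff_f)
  have poly_f: "poly (f c) (int x) = coord_val t a c x - coord_val t a' c x" for c x
    by (simp add: f_def poly_sum poly_monom coord_val_def b_def sum_subtractf left_diff_distrib)
  have form: "\<exists>h. f c = smult (b c t) (\<Prod>y\<in>int ` T. [:- y, 1:]) + smult q h" if "c \<in> C" for c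
  proof -
    have ci: "card (int ` T) = t" using T by (simp add: card_image)
    have "\<exists>h. f c = smult (coeff (f c) (card (int ` T))) (\<Prod>y\<in>int ` T. [:- y, 1:]) + smult q h"
    proof (rule poly_vanishing_mod)
      show "finite (int ` T)" using T by simp
      show "degree (f c) \<le> card (int ` T)" using deg ci by simp
      show "coprime (x - y) q" if "x \<in> int ` T" "y \<in> int ` T" "x \<noteq> y" for x y
        using that diff by (auto simp: q_def)
      show "q dvd poly (f c) y" if "y \<in> int ` T" for y
        using that agree[OF \<open>c \<in> C\<close>] by (auto simp: q_def poly_f)
    qed
    then show ?thesis unfolding ci by (simp add: coeff_f)
  qed
  \<comment> \<open>The common label cancels in the difference of the two codewords.\<close>
  have lin: "q dvd (\<Sum>x\<in>fst c. \<beta> x * poly (f c) (int x))" if "c \<in> C" "fst c \<subseteq> V" for c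
  proof -
    have "q dvd ((\<Sum>x\<in>fst c. \<beta> x * coord_val t a c x) - lab c)
        - ((\<Sum>x\<in>fst c. \<beta> x * coord_val t a' c x) - lab c)"
      unfolding q_def by (rule dvd_diff) (use a a' that in \<open>auto simp: labelled_code_def\<close>)
    then show ?thesis by (simp add: poly_f sum_subtractf right_diff_distrib)
  qed
  \<comment> \<open>Outside \<open>V\<close> leading coefficients are zero by definition; inside,
    the label form sends \<open>f c\<close> to \<open>b c t\<close> times a unit, modulo
    \<open>q\<close>.\<close>
  have off: "q dvd b c t" if c: "c \<in> C" "fst c \<noteq> T" for c
  proof (cases "fst c \<subseteq> V")
    case False
    then show ?thesis using a a' c by (simp add: labelled_code_def b_def)
  next
    case True
    obtain h where h: "f c = smult (b c t) (\<Prod>y\<in>int ` T. [:- y, 1:]) + smult q h"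
      using form c by blast
    have "poly (f c) (int x) = b c t * (\<Prod>y\<in>T. int x - int y) + q * poly h (int x)" for x
      by (subst h) (simp add: poly_prod prod.reindex)
    then have "(\<Sum>x\<in>fst c. \<beta> x * poly (f c) (int x)) =
        b c t * (\<Sum>x\<in>fst c. \<beta> x * (\<Prod>y\<in>T. int x - int y))
        + q * (\<Sum>x\<in>fst c. \<beta> x * poly h (int x))"
      by (simp add: sum.distrib sum_distrib_left distrib_left mult.left_commute)
    then have "q dvd b c t * (\<Sum>x\<in>fst c. \<beta> x * (\<Prod>y\<in>T. int x - int y))
        + q * (\<Sum>x\<in>fst c. \<beta> x * poly h (int x))"
      using lin[OF c(1) True] by simp
    then have "q dvd b c t * (\<Sum>x\<in>fst c. \<beta> x * (\<Prod>y\<in>T. int x - int y))"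
      by (simp only: dvd_add_left_iff[OF dvd_triv_left])
    moreover have "coprime q (\<Sum>x\<in>fst c. \<beta> x * (\<Prod>y\<in>T. int x - int y))"
      unfolding q_def by (subst coprime_commute) (rule unit[OF c])
    ultimately show ?thesis by (simp only: coprime_dvd_mult_left_iff)
  qed
  have top: "q dvd b c t" if c: "c \<in> C" for c
  proof (cases "fst c = T")
    case False
    then show ?thesis using off c by blast
  next
    case True
    then have c_eq: "c = (T, 0)" using single c by blast
    let ?I = "{c \<in> C. fst c \<subseteq> V}"
    have "q dvd (\<Sum>c\<in>?I. a (c, t)) - (\<Sum>c\<in>?I. a' (c, t))"
      using a a' unfolding q_def labelled_code_def by (intro dvd_diff) auto
    then have "q dvd (\<Sum>c\<in>?I. b c t)" by (simp add: b_def sum_subtractf)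
    moreover have "(\<Sum>c\<in>?I. b c t) = b (T, 0) t + (\<Sum>c\<in>?I - {(T, 0)}. b c t)"
      using c c_eq T \<open>finite C\<close> by (intro sum.remove) auto
    moreover have "q dvd (\<Sum>c\<in>?I - {(T, 0)}. b c t)"
      using single by (intro dvd_sum off) auto
    ultimately show ?thesis using c_eq by (simp only: dvd_add_left_iff)
  qed
  show "a = a'"
  proof (rule PiE_ext)
    show mem: "a \<in> C \<times> {..t} \<rightarrow>\<^sub>E {0..<q}" "a' \<in> C \<times> {..t} \<rightarrow>\<^sub>E {0..<q}"
      using a a' by (auto simp: labelled_code_def q_def)
    fix cj assume *: "cj \<in> C \<times> {..t}"
    then obtain c j where cj: "cj = (c, j)" "c \<in> C" "j \<le> t" by auto
    obtain h where h: "f c = smult (b c t) (\<Prod>y\<in>int ` T. [:- y, 1:]) + smult q h"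
      using form cj by blast
    have "b c j = coeff (f c) j" using cj by (simp add: coeff_f)
    also have "q dvd \<dots>"
      by (subst h) (use top cj in \<open>auto intro!: dvd_add\<close>)
    finally have "q dvd a cj - a' cj" by (simp add: b_def cj)
    \<comment> \<open>Coefficients are stored as reduced residues, so congruence modulo
      \<open>q\<close> is equality.\<close>
    moreover have "0 \<le> a cj" "a cj < q" "0 \<le> a' cj" "a' cj < q"
      using PiE_mem[OF mem(1) *] PiE_mem[OF mem(2) *] by auto
    ultimately show "a cj = a' cj"
      by (metis mod_eq_dvd_iff mod_pos_pos_trivial)
  qed
qed

text \<open>Each coordinate has \<open>t + 1\<close> coefficients and loses one: the constant one
  inside \<open>V\<close>, the leading one outside. The sum condition costs one more, which leaves
  \<open>t * card C - 1\<close> free.\<close>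

lemma card_labelled_code_ge:
  assumes "finite C" "c0 \<in> C" "fst c0 \<subseteq> V" "t \<ge> 1" "Q \<ge> 1"
    and unit: "\<And>c. c \<in> C \<Longrightarrow> coprime (\<Sum>x\<in>fst c. \<beta> x) (int Q)"
  shows "Q ^ (t * card C - 1) \<le> card (labelled_code Q t C \<beta> V lab)"
proof -
  define q where "q = int Q"
  have q: "q > 0" using assms by (simp add: q_def)
  define I where "I = {c \<in> C. fst c \<subseteq> V}"
  have I: "finite I" "I \<subseteq> C" "c0 \<in> I" using assms by (auto simp: I_def)
  \<comment> \<open>The constant coefficient enters the label form with the sum of weights as its
    factor; this inverse solves for it.\<close>
  obtain inv where inv: "q dvd (\<Sum>x\<in>fst c. \<beta> x) * inv c - 1" if "c \<in> C" for c
  proof -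
    have "\<exists>y. q dvd (\<Sum>x\<in>fst c. \<beta> x) * y - 1" if "c \<in> C" for c
      using cong_solve_coprime_int[OF unit[OF that]] by (auto simp: cong_iff_dvd_diff q_def)
    then show ?thesis using that by metis
  qed
  \<comment> \<open>The free coefficients: the constant ones inside \<open>V\<close> are determined by the labels, and the leading
    one of \<open>c0\<close> by the other leading ones.\<close>
  define D where "D = C \<times> {1..<t} \<union> (C - I) \<times> {0} \<union> (I - {c0}) \<times> {t}"
  define top where "top u c = (if c \<notin> I then 0 else
      if c = c0 then (- (\<Sum>c\<in>I - {c0}. u (c, t))) mod q else u (c, t))"
    for u :: "(nat set \<times> nat) \<times> nat \<Rightarrow> int" and c
  define R where "R u c = (\<Sum>x\<in>fst c. \<beta> x * ((\<Sum>j\<in>{1..<t}. u (c, j) * int x ^ j) + top u c * int x ^ t))"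
    for u c
  define ext where "ext u = (\<lambda>(c, j)\<in>C \<times> {..t}.
      if j = 0 then (if c \<in> I then ((lab c - R u c) * inv c) mod q else u (c, 0))
      else if j < t then u (c, j) else top u c)" for u
  \<comment> \<open>\<open>ext\<close> keeps the free coefficients, hence is injective.\<close>
  have ext_D: "ext u cj = u cj" if "cj \<in> D" for u cj
    using that I assms(4) by (auto simp: ext_def D_def top_def)
  have sub: "D \<subseteq> C \<times> {..t}" using I by (auto simp: D_def)
  have "finite D" using sub by (rule finite_subset) (use assms in auto)
  have "inj_on ext (D \<rightarrow>\<^sub>E {0..<q})"
  proof (rule inj_onI)
    fix u u' assume u: "u \<in> D \<rightarrow>\<^sub>E {0..<q}" "u' \<in> D \<rightarrow>\<^sub>E {0..<q}" and eq: "ext u = ext u'"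
    show "u = u'" using u by (rule PiE_ext) (metis eq ext_D)
  qed
  moreover have "ext ` (D \<rightarrow>\<^sub>E {0..<q}) \<subseteq> labelled_code Q t C \<beta> V lab"
  proof
    fix a assume "a \<in> ext ` (D \<rightarrow>\<^sub>E {0..<q})"
    then obtain u where u: "u \<in> D \<rightarrow>\<^sub>E {0..<q}" and a: "a = ext u" by auto
    have uD: "0 \<le> u cj \<and> u cj < q" if "cj \<in> D" for cj
      using PiE_mem[OF u that] by simp
    have a_top: "a (c, t) = top u c" if "c \<in> C" for c
      using that assms(4) by (simp add: a ext_def)
    have "0 \<le> a (c, j) \<and> a (c, j) < q" if cj: "c \<in> C" "j \<le> t" for c j
    proof (cases "(c, j) \<in> D")
      case True
      then show ?thesis using uD ext_D a by metis
    next
      case False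
      then have "j = 0 \<and> c \<in> I \<or> j = t \<and> (c \<notin> I \<or> c = c0)"
        using cj assms(4) by (auto simp: D_def)
      then show ?thesis
        using cj q assms(4) by (auto simp: a ext_def top_def)
    qed
    then have "a \<in> C \<times> {..t} \<rightarrow>\<^sub>E {0..<q}" by (auto simp: a ext_def)
    moreover have "\<forall>c\<in>C. \<not> fst c \<subseteq> V \<longrightarrow> a (c, t) = 0"
      using a_top by (auto simp: top_def I_def)
    moreover have "q dvd (\<Sum>c\<in>I. a (c, t))"
    proof -
      have "(\<Sum>c\<in>I. a (c, t)) = (\<Sum>c\<in>I. top u c)"
        using a_top I by (intro sum.cong) auto
      also have "\<dots> = top u c0 + (\<Sum>c\<in>I - {c0}. top u c)"
        using I by (intro sum.remove) auto
      also have "(\<Sum>c\<in>I - {c0}. top u c) = (\<Sum>c\<in>I - {c0}. u (c, t))"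
        by (intro sum.cong) (auto simp: top_def)
      also have "top u c0 = (- (\<Sum>c\<in>I - {c0}. u (c, t))) mod q"
        using I by (simp add: top_def)
      finally show ?thesis by (simp add: dvd_eq_mod_eq_0 mod_simps)
    qed
    moreover have "q dvd (\<Sum>x\<in>fst c. \<beta> x * coord_val t a c x) - lab c" if c: "c \<in> C" "fst c \<subseteq> V" for c
    proof -
      have cI: "c \<in> I" using c by (simp add: I_def)
      have "coord_val t a c x = a (c, 0) + ((\<Sum>j\<in>{1..<t}. u (c, j) * int x ^ j) + top u c * int x ^ t)" for x
      proof -
        have "{..t} = insert 0 (insert t {1..<t})" using assms(4) by auto
        then have "coord_val t a c x = a (c, 0) + (a (c, t) * int x ^ t + (\<Sum>j\<in>{1..<t}. a (c, j) * int x ^ j))"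
          using assms(4) by (simp add: coord_val_def)
        also have "(\<Sum>j\<in>{1..<t}. a (c, j) * int x ^ j) = (\<Sum>j\<in>{1..<t}. u (c, j) * int x ^ j)"
          using c by (intro sum.cong) (auto simp: a ext_def)
        finally show ?thesis using a_top[OF c(1)] by simp
      qed
      then have "(\<Sum>x\<in>fst c. \<beta> x * coord_val t a c x) = a (c, 0) * (\<Sum>x\<in>fst c. \<beta> x) + R u c"
        by (simp add: R_def sum.distrib sum_distrib_left sum_distrib_right algebra_simps)
      moreover have "a (c, 0) = ((lab c - R u c) * inv c) mod q"
        using c cI by (simp add: a ext_def)
      moreover have "q dvd (((lab c - R u c) * inv c) mod q) * (\<Sum>x\<in>fst c. \<beta> x) + R u c - lab c"
      proof -
        obtain w where w: "(\<Sum>x\<in>fst c. \<beta> x) * inv c = 1 + q * w"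
          using inv[OF c(1)] by (metis add.commute diff_add_cancel dvdE)
        have "((lab c - R u c) * inv c) mod q * (\<Sum>x\<in>fst c. \<beta> x) + R u c - lab c
          = (lab c - R u c) * ((\<Sum>x\<in>fst c. \<beta> x) * inv c - 1)
            - q * (((lab c - R u c) * inv c) div q * (\<Sum>x\<in>fst c. \<beta> x))"
          by (simp add: minus_mult_div_eq_mod[symmetric] algebra_simps)
        also have "q dvd \<dots>" by (simp add: w)
        finally show ?thesis .
      qed
      ultimately show ?thesis by simp
    qed
    ultimately show "a \<in> labelled_code Q t C \<beta> V lab"
      by (simp add: labelled_code_def q_def I_def)
  qed
  moreover have "finite (labelled_code Q t C \<beta> V lab)"
    by (rule finite_subset[of _ "C \<times> {..t} \<rightarrow>\<^sub>E {0..<int Q}"])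
      (use assms in \<open>auto simp: labelled_code_def intro!: finite_PiE\<close>)
  ultimately have "card (D \<rightarrow>\<^sub>E {0..<q}) \<le> card (labelled_code Q t C \<beta> V lab)"
    by (meson card_inj_on_le)
  moreover have "card (D \<rightarrow>\<^sub>E {0..<q}) = Q ^ card D"
    using \<open>finite D\<close> by (simp add: card_PiE q_def)
  moreover have "card D = t * card C - 1"
  proof -
    have "card D = card (C \<times> {1..<t}) + card ((C - I) \<times> {0::nat}) + card ((I - {c0}) \<times> {t})"
      unfolding D_def using assms(1) I(1) by (subst card_Un_disjoint; auto)+
    also have "\<dots> = card C * (t - 1) + (card C - card I) + (card I - 1)"
      using I assms by (simp add: card_Diff_subset card_cartesian_product)
    also have "\<dots> = t * card C - 1"
    proof -
      have "card I \<le> card C" "card I \<ge> 1"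
        using I assms(1) by (auto intro: card_mono simp: Suc_le_eq card_gt_0_iff)
      then show ?thesis using assms(4) by (cases t) (auto simp: algebra_simps)
    qed
    finally show ?thesis .
  qed
  ultimately show ?thesis by simp
qed

section \<open>Induced packings\<close>

text \<open>Extensional functions make the set finite and let a placement be determined by its
  values on [k].\<close>

definition placements :: "nat \<Rightarrow> nat \<Rightarrow> (nat \<Rightarrow> nat) set" where
  "placements k v = {\<phi> \<in> {1..k} \<rightarrow>\<^sub>E {1..v}. inj_on \<phi> {1..k}}"

lemma finite_placements: "finite (placements k v)"
  by (simp add: placements_def finite_PiE)

text \<open>A permutation of [v] carrying \<open>T\<close> to \<open>T'\<close> acts injectively on
  placements by composition. Exchanging \<open>T\<close> and \<open>T'\<close> gives the reverse
  inequality.\<close>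

lemma card_placements_through_le:
  assumes G: "G \<subseteq> nsets {1..k} t" and T: "T \<in> nsets {1..v} t" and T': "T' \<in> nsets {1..v} t"
  shows "card {\<phi> \<in> placements k v. T \<in> (`) \<phi> ` G} \<le> card {\<phi> \<in> placements k v. T' \<in> (`) \<phi> ` G}"
proof -
  have fin: "finite T" "finite T'" and card: "card T = card T'" and sub: "T \<subseteq> {1..v}" "T' \<subseteq> {1..v}"
    using T T' by (auto simp: nsets_def)
  obtain f where f: "bij_betw f T T'"
    using finite_same_card_bij[OF fin card] by blast
  have "card ({1..v} - T) = card ({1..v} - T')"
    using sub fin card by (simp add: card_Diff_subset)
  then obtain g where g: "bij_betw g ({1..v} - T) ({1..v} - T')"
    using finite_same_card_bij[of "{1..v} - T" "{1..v} - T'"] by auto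
  define \<pi> where "\<pi> x = (if x \<in> T then f x else g x)" for x
  have f_in: "f z \<in> T'" if "z \<in> T" for z
    using bij_betwE[OF f] that by blast
  have g_in: "g z \<in> {1..v} - T'" if "z \<in> {1..v}" "z \<notin> T" for z
    using bij_betwE[OF g] that by blast
  have pi_img: "\<pi> ` T = T'" using f by (auto simp: \<pi>_def bij_betw_def)
  have pi_in: "\<pi> x \<in> {1..v}" if "x \<in> {1..v}" for x
    using that f_in[of x] g_in[of x] sub by (auto simp: \<pi>_def)
  have pi_inj: "inj_on \<pi> {1..v}"
  proof (rule inj_onI)
    fix x y assume xy: "x \<in> {1..v}" "y \<in> {1..v}" and eq: "\<pi> x = \<pi> y"
    have "x \<in> T \<longleftrightarrow> y \<in> T" 
      using f_in[of x] g_in[of x] f_in[of y] g_in[of y] xy eq by (auto simp: \<pi>_def split: if_splits)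
    then show "x = y"
      using xy eq f g by (auto simp: \<pi>_def bij_betw_def inj_on_def split: if_splits)
  qed
  show ?thesis
  proof (rule card_inj_on_le)
    let ?h = "\<lambda>\<phi>. restrict (\<pi> \<circ> \<phi>) {1..k}"
    show "inj_on ?h {\<phi> \<in> placements k v. T \<in> (`) \<phi> ` G}"
    proof (rule inj_onI)
      fix \<phi> \<psi> assume *: "\<phi> \<in> {\<phi> \<in> placements k v. T \<in> (`) \<phi> ` G}"
        "\<psi> \<in> {\<phi> \<in> placements k v. T \<in> (`) \<phi> ` G}" and eq: "?h \<phi> = ?h \<psi>"
      have mem: "\<phi> \<in> {1..k} \<rightarrow>\<^sub>E {1..v}" "\<psi> \<in> {1..k} \<rightarrow>\<^sub>E {1..v}"
        using * by (auto simp: placements_def)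
      show "\<phi> = \<psi>"
      proof (rule PiE_ext[OF mem])
        fix x assume x: "x \<in> {1..k}"
        have "\<pi> (\<phi> x) = \<pi> (\<psi> x)" using fun_cong[OF eq, of x] x by simp
        then show "\<phi> x = \<psi> x"
          using pi_inj PiE_mem[OF mem(1) x] PiE_mem[OF mem(2) x] by (meson inj_onD)
      qed
    qed
    show "?h ` {\<phi> \<in> placements k v. T \<in> (`) \<phi> ` G} \<subseteq> {\<phi> \<in> placements k v. T' \<in> (`) \<phi> ` G}"
    proof clarify
      fix \<phi> g assume \<phi>: "\<phi> \<in> placements k v" and g: "g \<in> G" "T = \<phi> ` g"
      have mem: "\<phi> x \<in> {1..v}" if "x \<in> {1..k}" for x
        using \<phi> that by (auto simp: placements_def)
      have "inj_on (\<pi> \<circ> \<phi>) {1..k}"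
        using \<phi> mem
        by (intro comp_inj_on inj_on_subset[OF pi_inj]) (auto simp: placements_def simp del: atLeastAtMost_iff)
      then have "inj_on (?h \<phi>) {1..k}" by (simp only: inj_on_restrict_eq)
      moreover have "?h \<phi> \<in> {1..k} \<rightarrow>\<^sub>E {1..v}"
        using mem pi_in unfolding restrict_PiE_iff comp_def by blast
      ultimately have "?h \<phi> \<in> placements k v" unfolding placements_def by blast
      moreover have "?h \<phi> ` g = T'"
      proof -
        have gk: "g \<subseteq> {1..k}" using g G by (auto simp: nsets_def)
        have "?h \<phi> ` g = (\<pi> \<circ> \<phi>) ` g"
          by (rule image_cong) (use gk in auto)
        then have "?h \<phi> ` g = \<pi> ` (\<phi> ` g)"
          by (simp add: image_comp)
        then show ?thesis using g pi_img by simp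
      qed
      ultimately show "?h \<phi> \<in> placements k v \<and> T' \<in> (`) (?h \<phi>) ` G" using g by blast
    qed
    show "finite {\<phi> \<in> placements k v. T' \<in> (`) \<phi> ` G}" using finite_placements by simp
  qed
qed

text \<open>Double counting of pairs of a placement and a set in its copy of \<open>G\<close>; an
  injective \<open>\<phi>\<close> maps distinct members of \<open>G\<close> to distinct
  sets.\<close>

lemma card_placements_through:
  assumes G: "G \<subseteq> nsets {1..k} t" "G \<noteq> {}" and "t \<le> k" "k \<le> v"
  shows "\<exists>m>0. (\<forall>T\<in>nsets {1..v} t. card {\<phi> \<in> placements k v. T \<in> (`) \<phi> ` G} = m) \<and>
    card (placements k v) * card G = m * (v choose t)"
proof -
  have "card (nsets {1..v} t) > 0" using assms by simp
  then obtain T0 where T0: "T0 \<in> nsets {1..v} t"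
    unfolding card_gt_0_iff by blast
  define m where "m = card {\<phi> \<in> placements k v. T0 \<in> (`) \<phi> ` G}"
  have m: "card {\<phi> \<in> placements k v. T \<in> (`) \<phi> ` G} = m" if "T \<in> nsets {1..v} t" for T
    unfolding m_def using card_placements_through_le[OF G(1)] T0 that by (meson le_antisym)
  have finG: "finite G" using G(1) by (rule finite_subset) (simp add: finite_imp_finite_nsets)
  have "(\<Sum>T\<in>nsets {1..v} t. card {\<phi> \<in> placements k v. T \<in> (`) \<phi> ` G}) = card G * card (placements k v)"
  proof (rule sum_multicount)
    show "\<forall>\<phi>\<in>placements k v. card {T \<in> nsets {1..v} t. T \<in> (`) \<phi> ` G} = card G"
    proof
      fix \<phi> assume \<phi>: "\<phi> \<in> placements k v"
      have sub: "g \<subseteq> {1..k}" "finite g" "card g = t" if "g \<in> G" for g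
        using that G(1) by (auto simp: nsets_def)
      have inj: "inj_on \<phi> {1..k}" and img: "\<phi> ` {1..k} \<subseteq> {1..v}"
        using \<phi> by (auto simp: placements_def)
      have "\<phi> ` g \<in> nsets {1..v} t" if "g \<in> G" for g
        using sub[OF that] inj img inj_on_subset[OF inj, of g]
        by (auto simp: nsets_def card_image)
      then have "{T \<in> nsets {1..v} t. T \<in> (`) \<phi> ` G} = (`) \<phi> ` G" by auto
      moreover have "inj_on ((`) \<phi>) G"
        by (rule inj_onI) (metis inj sub(1) inj_on_image_eq_iff)
      ultimately show "card {T \<in> nsets {1..v} t. T \<in> (`) \<phi> ` G} = card G"
        by (simp add: card_image)
    qed
  qed (simp_all add: finite_placements finite_imp_finite_nsets)
  moreover have "(\<Sum>T\<in>nsets {1..v} t. card {\<phi> \<in> placements k v. T \<in> (`) \<phi> ` G})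
      = (v choose t) * m"
    using m by simp
  ultimately have count: "card (placements k v) * card G = m * (v choose t)"
    by (simp add: mult.commute)
  \<comment> \<open>The inclusion of [k] in [v] is a placement, so the count is positive and
    \<open>m\<close> can serve as a divisor later.\<close>
  have "restrict id {1..k} \<in> placements k v"
    using \<open>k \<le> v\<close> by (auto simp: placements_def inj_on_def)
  then have "card (placements k v) > 0" using finite_placements by (auto simp: card_gt_0_iff)
  moreover have "card G > 0" using finG G(2) by (simp add: card_gt_0_iff)
  ultimately have "m > 0" using count by (metis gr0I mult_is_0)
  then show ?thesis using m count by blast
qed

section \<open>Packings built from labelled codes\<close>

text \<open>Edges are recorded as injections of [k] because the copy of \<open>G\<close> on an edge
  depends on the injection, not only on its image.\<close>

definition induced_packing :: "nat \<Rightarrow> nat \<Rightarrow> nat set set \<Rightarrow> nat \<Rightarrow> (nat \<Rightarrow> nat) set \<Rightarrow> bool" where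
  "induced_packing k t G n \<Psi> \<longleftrightarrow>
     (\<forall>\<psi>\<in>\<Psi>. inj_on \<psi> {1..k} \<and> \<psi> ` {1..k} \<subseteq> {1..n}) \<and>
     (\<forall>\<psi>\<in>\<Psi>. \<forall>\<psi>'\<in>\<Psi>. \<psi> \<noteq> \<psi>' \<longrightarrow>
        card (\<psi> ` {1..k} \<inter> \<psi>' ` {1..k}) \<le> t \<and> (\<forall>g\<in>G. \<not> \<psi> ` g \<subseteq> \<psi>' ` {1..k}))"

text \<open>Only finitely many integers must become units, so one \<open>L\<close> and one
  \<open>\<beta>\<close> serve a whole progression of moduli, and \<open>j\<close> stays free to
  grow.\<close>

lemma modulus_with_units:
  "\<exists>L>0. \<exists>\<beta> :: nat \<Rightarrow> int. \<forall>j.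
     (\<forall>X T. X \<subseteq> {1..v} \<longrightarrow> T \<subseteq> {1..v} \<longrightarrow> \<not> X \<subseteq> T \<longrightarrow>
       coprime (\<Sum>x\<in>X. \<beta> x * (\<Prod>y\<in>T. int x - int y)) (int (1 + L * j))) \<and>
     (\<forall>x\<in>{1..v}. \<forall>y\<in>{1..v}. x \<noteq> y \<longrightarrow> coprime (int x - int y) (int (1 + L * j)))"
proof -
  obtain \<beta> :: "nat \<Rightarrow> int" where \<beta>: "\<And>X T. X \<subseteq> {1..v} \<Longrightarrow> T \<subseteq> {1..v} \<Longrightarrow> \<not> X \<subseteq> T \<Longrightarrow>
       (\<Sum>x\<in>X. \<beta> x * (\<Prod>y\<in>T. int x - int y)) \<noteq> 0"
    using separating_weights[of v] by blast
  define S where "S XT = (\<Sum>x\<in>fst XT. \<beta> x * (\<Prod>y\<in>snd XT. int x - int y))" for XT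
  define d where "d xy = int (fst xy) - int (snd xy)" for xy
  define A where "A = {XT \<in> Pow {1..v} \<times> Pow {1..v}. \<not> fst XT \<subseteq> snd XT}"
  define B where "B = {xy \<in> {1..v} \<times> {1..v}. fst xy \<noteq> snd xy}"
  have "finite A" "finite B"
    unfolding A_def B_def by (rule finite_subset[OF Collect_restrict]; simp)+
  then have "finite (S ` A \<union> d ` B)" by blast
  moreover have "0 \<notin> S ` A \<union> d ` B"
  proof -
    have "S XT \<noteq> 0" if "XT \<in> A" for XT
      unfolding S_def by (rule \<beta>) (use that in \<open>auto simp: A_def\<close>)
    moreover have "d xy \<noteq> 0" if "xy \<in> B" for xy using that by (simp add: d_def B_def)
    ultimately show ?thesis by force
  qed
  ultimately show ?thesis
  proof (rule finite_coprime_modulus)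
    fix L :: nat
    assume L: "L > 0" "\<And>j z. z \<in> S ` A \<union> d ` B \<Longrightarrow> coprime z (int (1 + L * j))"
    show ?thesis
    proof (intro exI[of _ L] exI[of _ \<beta>] conjI allI impI ballI)
      show "L > 0" by (rule L(1))
      fix j X T assume "X \<subseteq> {1..v}" "T \<subseteq> {1..v}" "\<not> X \<subseteq> T"
      then have "(X, T) \<in> A" by (simp add: A_def)
      then have "coprime (S (X, T)) (int (1 + L * j))" by (intro L(2) UnI1 imageI)
      then show "coprime (\<Sum>x\<in>X. \<beta> x * (\<Prod>y\<in>T. int x - int y)) (int (1 + L * j))"
        by (simp only: S_def fst_conv snd_conv)
    next
      fix j x y :: nat assume "x \<in> {1..v}" "y \<in> {1..v}" "x \<noteq> y"
      then have "(x, y) \<in> B" by (simp add: B_def)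
      then have "coprime (d (x, y)) (int (1 + L * j))" by (intro L(2) UnI2 imageI)
      then show "coprime (int x - int y) (int (1 + L * j))"
        by (simp only: d_def fst_conv snd_conv)
    qed
  qed
qed

text \<open>Edges are indexed by a placement, a repetition index and a codeword; a point of an edge
  pairs an element of [v] with the value of the word there. Common points of two edges are thus
  places where their words agree, and enough agreement identifies the indices.\<close>

lemma code_packing:
  fixes k t v Q m n :: nat and C :: "(nat set \<times> nat) set"
  defines "C \<equiv> nsets {1..v} t \<times> {0} \<union> nsets {1..v} (Suc t) \<times> {..k}"
  assumes t: "1 \<le> t" "t \<le> k" and kv: "k \<le> v" and Qv: "v < Q" and G: "G \<subseteq> nsets {1..k} t" "G \<noteq> {}"
    and unit: "\<And>X T. X \<subseteq> {1..v} \<Longrightarrow> T \<subseteq> {1..v} \<Longrightarrow> \<not> X \<subseteq> T \<Longrightarrow>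
       coprime (\<Sum>x\<in>X. \<beta> x * (\<Prod>y\<in>T. int x - int y)) (int Q)"
    and diff: "\<And>x y. x \<in> {1..v} \<Longrightarrow> y \<in> {1..v} \<Longrightarrow> x \<noteq> y \<Longrightarrow> coprime (int x - int y) (int Q)"
    and m: "0 < m" "\<And>T. T \<in> nsets {1..v} t \<Longrightarrow> card {\<phi> \<in> placements k v. T \<in> (`) \<phi> ` G} = m"
    and n: "v * Q ^ card C \<le> n"
  shows "\<exists>\<Psi>. finite \<Psi> \<and> induced_packing k t G n \<Psi> \<and>
     card (placements k v) * ((Q - 1) div m) * Q ^ (t * card C - 1) \<le> card \<Psi>"
proof -
  \<comment> \<open>Each \<open>t\<close>-set lies in the copies of \<open>G\<close> of
    \<open>m * \<mu>\<close> pairs of a placement and a repetition index, and these must receive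
    distinct labels among the \<open>Q - 1\<close> nonzero residues.\<close>
  define \<mu> where "\<mu> = (Q - 1) div m"
  have finC: "finite C" by (simp add: C_def finite_imp_finite_nsets)
  have C_cases: "fst c \<in> nsets {1..v} t \<and> snd c = 0 \<or> fst c \<in> nsets {1..v} (Suc t) \<and> snd c \<le> k"
    if "c \<in> C" for c
    using that unfolding C_def by fastforce
  have C_sub: "fst c \<subseteq> {1..v}" and C_card: "card (fst c) \<in> {t, Suc t}" if "c \<in> C" for c
    using C_cases[OF that] unfolding nsets_def by blast+
  have C_t: "fst c \<in> nsets {1..v} t" if "c \<in> C" "card (fst c) = t" for c
    using C_cases[OF that(1)] that(2) unfolding nsets_def by fastforce
  have C_snd: "snd c \<le> k" if "c \<in> C" for c
    using C_cases[OF that] by auto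
  define P where "P = placements k v"
  have P: "\<phi> x \<in> {1..v}" if "\<phi> \<in> P" "x \<in> {1..k}" for \<phi> x
    using that by (auto simp: P_def placements_def)
  have P_inj: "inj_on \<phi> {1..k}" if "\<phi> \<in> P" for \<phi>
    using that by (auto simp: P_def placements_def)
  define B where "B T = {p \<in> P \<times> {..<\<mu>}. T \<in> (`) (fst p) ` G}" for T
  have "\<exists>e. inj_on e (B T) \<and> e ` B T \<subseteq> {1..<Q}" if "T \<in> nsets {1..v} t" for T
  proof -
    have "B T = {\<phi> \<in> P. T \<in> (`) \<phi> ` G} \<times> {..<\<mu>}" by (auto simp: B_def)
    then have "card (B T) = m * \<mu>"
      using m(2)[OF that] by (simp add: P_def card_cartesian_product)
    also have "\<dots> \<le> card {1..<Q}" by (simp add: \<mu>_def)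
    finally show ?thesis
      using card_le_inj[of "B T" "{1..<Q}"] finite_placements by (auto simp: B_def P_def)
  qed
  then obtain e where e: "\<And>T. T \<in> nsets {1..v} t \<Longrightarrow> inj_on (e T) (B T) \<and> e T ` B T \<subseteq> {1..<Q}"
    by metis
  \<comment> \<open>The label 0 is reserved for the \<open>t\<close>-sets outside the copy of \<open>G\<close>; the labels of a
    $(t+1)$-set spell out the whole pair \<open>p\<close>.\<close>
  define lab where "lab p c = int (if card (fst c) = t then (if p \<in> B (fst c) then e (fst c) p else 0)
      else if snd c = 0 then snd p else fst p (snd c))" for p :: "(nat \<Rightarrow> nat) \<times> nat" and c :: "nat set \<times> nat"
  \<comment> \<open>Labels are reduced residues, so labels congruent modulo \<open>Q\<close> are
    equal.\<close>
  have lab_range: "lab p c \<in> {0..<int Q}" if p: "p \<in> P \<times> {..<\<mu>}" and c: "c \<in> C" for p c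
  proof (cases "card (fst c) = t")
    case True
    have "e (fst c) p \<in> {1..<Q}" if "p \<in> B (fst c)"
      using e[OF C_t[OF c True]] that by blast
    then show ?thesis using True Qv by (auto simp: lab_def)
  next
    case False
    have "\<mu> \<le> Q - 1" by (simp add: \<mu>_def)
    then have "snd p < Q" using p by auto
    moreover have "fst p (snd c) < Q" if "snd c \<noteq> 0"
    proof -
      have "fst p (snd c) \<in> {1..v}" using p that C_snd[OF c] by (intro P) auto
      then show ?thesis using Qv by simp
    qed
    ultimately show ?thesis using False by (simp add: lab_def)
  qed
  define K where "K p = labelled_code Q t C \<beta> (fst p ` {1..k}) (lab p)" for p
  define I where "I = Sigma (P \<times> {..<\<mu>}) K"
  define w where "w a x = (\<lambda>c\<in>C. coord_val t a c x mod int Q)" for a :: "(nat set \<times> nat) \<times> nat \<Rightarrow> int" and x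
  \<comment> \<open>There are exactly \<open>v * Q ^ card C\<close> points, at most
    \<open>n\<close>, so some injection \<open>enc\<close> names them by elements of [n].\<close>
  define pts where "pts = {1..v} \<times> (C \<rightarrow>\<^sub>E {0..<int Q})"
  have pts: "finite pts" "card pts \<le> n"
    using finC n by (auto simp: pts_def finite_PiE card_cartesian_product card_PiE)
  then obtain enc where enc: "inj_on enc pts" "enc ` pts \<subseteq> {1..n}"
    using card_le_inj[of pts "{1..n}"] by auto
  have w_pts: "(x, w a x) \<in> pts" if "x \<in> {1..v}" for x a
    using that Qv by (auto simp: pts_def w_def)
  define \<psi> where "\<psi> q = (\<lambda>j\<in>{1..k}. enc (fst (fst q) j, w (snd q) (fst (fst q) j)))"
    for q :: "((nat \<Rightarrow> nat) \<times> nat) \<times> ((nat set \<times> nat) \<times> nat \<Rightarrow> int)"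
  have P_I: "fst (fst q) \<in> P" if "q \<in> I" for q using that by (auto simp: I_def)
  \<comment> \<open>Agreement on \<open>X\<close> equates the labels of all coordinates inside
    \<open>X\<close>; these determine the pair \<open>p\<close>; with equal labels, a
    \<open>t\<close>-subset of \<open>X\<close> then determines the codeword.\<close>
  have sep: "q = q'"
    if q: "q \<in> I" and q': "q' \<in> I"
      and X: "X \<subseteq> fst (fst q) ` {1..k}" "X \<subseteq> fst (fst q') ` {1..k}"
      and agree: "\<And>x. x \<in> X \<Longrightarrow> w (snd q) x = w (snd q') x"
      and size: "X \<in> (`) (fst (fst q)) ` G \<or> t < card X" for q q' X
  proof -
    obtain p a p' a' where qp: "q = (p, a)" "q' = (p', a')" by (metis surj_pair)
    have p: "p \<in> P \<times> {..<\<mu>}" "p' \<in> P \<times> {..<\<mu>}" and a: "a \<in> K p" "a' \<in> K p'"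
      using q q' by (auto simp: I_def qp)
    have Xv: "X \<subseteq> {1..v}"
      using X(1) P[of "fst p"] p(1) by (auto simp: qp)
    have tr: "int Q dvd coord_val t a c x - coord_val t a' c x" if "c \<in> C" "x \<in> X" for c x
      using fun_cong[OF agree[OF that(2)], of c] that(1) by (simp add: w_def qp mod_eq_dvd_iff)
    have lab_eq: "lab p c = lab p' c" if c: "c \<in> C" "fst c \<subseteq> X" for c
    proof -
      let ?s = "\<lambda>a. \<Sum>x\<in>fst c. \<beta> x * coord_val t a c x"
      have d: "int Q dvd ?s a - lab p c" "int Q dvd ?s a' - lab p' c"
        using a c X by (auto simp: K_def labelled_code_def qp)
      have d': "int Q dvd ?s a - ?s a'"
        unfolding sum_subtractf[symmetric] right_diff_distrib[symmetric]
        using c by (intro dvd_sum dvd_mult tr) auto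
      have "lab p c - lab p' c = (?s a - ?s a') - (?s a - lab p c) + (?s a' - lab p' c)" by simp
      also have "int Q dvd \<dots>" by (rule dvd_add[OF dvd_diff[OF d' d(1)] d(2)])
      finally have "int Q dvd lab p c - lab p' c" .
      then have "lab p c mod int Q = lab p' c mod int Q"
        by (simp add: mod_eq_dvd_iff)
      then show ?thesis using lab_range[OF p(1) c(1)] lab_range[OF p(2) c(1)] by simp
    qed
    have same: "p = p' \<and> (\<exists>T\<in>nsets {1..v} t. T \<subseteq> X)"
    proof (cases "t < card X")
      case True
      \<comment> \<open>A single \<open>(t+1)\<close>-subset suffices: its index 0 reveals the
        repetition index, its index \<open>b > 0\<close> the value of the placement at
        \<open>b\<close>.\<close>
      then obtain S where S: "S \<subseteq> X" "card S = Suc t" "finite S"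
        using obtain_subset_with_card_n[of "Suc t" X] by auto
      then have SC: "(S, b) \<in> C" if "b \<le> k" for b
        using Xv that by (auto simp: C_def nsets_def)
      have "lab p (S, b) = lab p' (S, b)" if "b \<le> k" for b
        using lab_eq[OF SC[OF that]] S by simp
      then have lab_S: "(if b = 0 then snd p else fst p b) = (if b = 0 then snd p' else fst p' b)"
        if "b \<le> k" for b
        using that S(2) by (fastforce simp: lab_def split: if_splits)
      have "fst p = fst p'"
      proof (rule PiE_ext)
        show "fst p \<in> {1..k} \<rightarrow>\<^sub>E {1..v}" "fst p' \<in> {1..k} \<rightarrow>\<^sub>E {1..v}"
          using p by (auto simp: P_def placements_def)
        show "fst p j = fst p' j" if "j \<in> {1..k}" for j
          using lab_S[of j] that by simp
      qed
      moreover have "snd p = snd p'" using lab_S[of 0] by simp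
      moreover obtain T where "T \<subseteq> S" "card T = t" "finite T"
        using obtain_subset_with_card_n[of t S] S by auto
      ultimately show ?thesis using S Xv by (auto simp: prod_eq_iff nsets_def intro!: exI[of _ T])
    next
      case False
      then obtain g where g: "g \<in> G" "X = fst p ` g" using size by (auto simp: qp)
      then have "g \<subseteq> {1..k}" "card g = t" "finite g" using G by (auto simp: nsets_def)
      then have XT: "X \<in> nsets {1..v} t" "card X = t"
        using g Xv P_inj[of "fst p"] p(1) by (auto simp: nsets_def card_image inj_on_subset)
      then have "(X, 0) \<in> C" by (simp add: C_def)
      then have leq: "lab p (X, 0) = lab p' (X, 0)" by (intro lab_eq) auto
      have pB: "p \<in> B X" using p g by (auto simp: B_def)
      \<comment> \<open>\<open>p\<close> has a nonzero label at \<open>X\<close>, so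
        \<open>p'\<close> cannot carry the reserved 0; injectivity of \<open>e X\<close> on
        \<open>B X\<close> then gives \<open>p = p'\<close>.\<close>
      then have "e X p \<in> {1..<Q}" using e[OF XT(1)] by blast
      then have "p' \<in> B X \<and> e X p = e X p'"
        using leq XT pB by (auto simp: lab_def split: if_splits)
      then have "p = p'" using e[OF XT(1)] pB by (meson inj_onD)
      then show ?thesis using XT by blast
    qed
    then obtain T where T: "T \<in> nsets {1..v} t" "T \<subseteq> X" by blast
    have T': "finite T" "card T = t" "T \<subseteq> {1..v}" using T by (auto simp: nsets_def)
    have "a = a'"
    proof (rule labelled_code_eqI)
      show "a \<in> labelled_code Q t C \<beta> (fst p ` {1..k}) (lab p)" "a' \<in> labelled_code Q t C \<beta> (fst p ` {1..k}) (lab p)"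
        using a same by (auto simp: K_def)
      show "T \<subseteq> fst p ` {1..k}" using T X by (auto simp: qp)
      show "{c \<in> C. fst c = T} = {(T, 0)}"
      proof -
        have "c = (T, 0)" if "c \<in> C" "fst c = T" for c
          using C_cases[OF that(1)] that(2) T' by (cases c) (simp add: nsets_def)
        moreover have "(T, 0) \<in> C" unfolding C_def using T(1) by blast
        ultimately show ?thesis by fastforce
      qed
      show "coprime (\<Sum>x\<in>fst c. \<beta> x * (\<Prod>y\<in>T. int x - int y)) (int Q)" if c: "c \<in> C" "fst c \<noteq> T" for c
      proof (rule unit)
        \<comment> \<open>Coordinates have at least \<open>t\<close> elements, so no set other than
          \<open>T\<close> itself lies inside \<open>T\<close>.\<close>
        show "\<not> fst c \<subseteq> T"
        proof
          assume sub: "fst c \<subseteq> T"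
          then have "card (fst c) \<le> t" using card_mono[OF T'(1) sub] T' by simp
          then have "card (fst c) = t" using C_card[OF c(1)] by auto
          then show False using card_subset_eq[OF T'(1) sub] T' c(2) by simp
        qed
      qed (use T' C_sub[OF c(1)] in auto)
      show "coprime (int x - int y) (int Q)" if "x \<in> T" "y \<in> T" "x \<noteq> y" for x y
        using diff that T' by blast
      show "int Q dvd coord_val t a c x - coord_val t a' c x" if "c \<in> C" "x \<in> T" for c x
        using tr that T by blast
    qed (use T' finC in auto)
    then show ?thesis using same by (simp add: qp)
  qed
  have enc_eq: "x = y \<and> w a x = w a' y" if "enc (x, w a x) = enc (y, w a' y)" "x \<in> {1..v}" "y \<in> {1..v}" for x y a a'
    using inj_onD[OF enc(1) that(1)] w_pts that by blast
  have packed: "card (\<psi> q ` {1..k} \<inter> \<psi> q' ` {1..k}) \<le> t \<and> (\<forall>g\<in>G. \<not> \<psi> q ` g \<subseteq> \<psi> q' ` {1..k})"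
    if q: "q \<in> I" "q' \<in> I" and ne: "q \<noteq> q'" for q q'
  proof -
    \<comment> \<open>As \<open>enc\<close> is injective, the common points of the two edges lie
      above \<open>X\<close>.\<close>
    define X where "X = {x \<in> fst (fst q) ` {1..k} \<inter> fst (fst q') ` {1..k}. w (snd q) x = w (snd q') x}"
    have meet: "fst (fst q) j \<in> X" if j: "j \<in> {1..k}" and hit: "\<psi> q j \<in> \<psi> q' ` {1..k}" for j
    proof -
      obtain j' where j': "j' \<in> {1..k}" "\<psi> q j = \<psi> q' j'" using hit by blast
      then have "enc (fst (fst q) j, w (snd q) (fst (fst q) j)) = enc (fst (fst q') j', w (snd q') (fst (fst q') j'))"
        using j unfolding \<psi>_def by (simp only: restrict_apply if_True)
      then have eq: "fst (fst q) j = fst (fst q') j' \<and> w (snd q) (fst (fst q) j) = w (snd q') (fst (fst q') j')"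
        using P P_I q j j'(1) by (intro enc_eq) blast+
      have m: "fst (fst q) j \<in> fst (fst q) ` {1..k}" "fst (fst q) j \<in> fst (fst q') ` {1..k}"
        using j j'(1) eq by (metis imageI)+
      show ?thesis unfolding X_def by (intro CollectI conjI IntI m) (metis eq)
    qed
    have finX: "finite X" by (auto simp: X_def)
    have X: "X \<subseteq> fst (fst q) ` {1..k}" "X \<subseteq> fst (fst q') ` {1..k}"
      unfolding X_def by blast+
    have X_agree: "w (snd q) x = w (snd q') x" if "x \<in> X" for x
      using that unfolding X_def by blast
    have "\<not> t < card X"
      using sep[OF q X X_agree] ne by blast
    moreover have "\<psi> q ` {1..k} \<inter> \<psi> q' ` {1..k} \<subseteq> (\<lambda>x. enc (x, w (snd q) x)) ` X"
    proof
      fix z assume "z \<in> \<psi> q ` {1..k} \<inter> \<psi> q' ` {1..k}"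
      then obtain j where j: "j \<in> {1..k}" "z = \<psi> q j" "\<psi> q j \<in> \<psi> q' ` {1..k}" by blast
      then have "z = enc (fst (fst q) j, w (snd q) (fst (fst q) j))" by (simp add: \<psi>_def)
      then show "z \<in> (\<lambda>x. enc (x, w (snd q) x)) ` X" using meet[OF j(1,3)] by blast
    qed
    then have "card (\<psi> q ` {1..k} \<inter> \<psi> q' ` {1..k}) \<le> card X"
      using finX by (meson card_image_le card_mono finite_imageI le_trans)
    moreover have "\<not> \<psi> q ` g \<subseteq> \<psi> q' ` {1..k}" if g: "g \<in> G" for g
    proof
      assume sub: "\<psi> q ` g \<subseteq> \<psi> q' ` {1..k}"
      have "g \<subseteq> {1..k}" using g G by (auto simp: nsets_def)
      then have "fst (fst q) ` g \<subseteq> X" using sub meet by blast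
      then have "q = q'" using g X X_agree by (intro sep[OF q, of "fst (fst q) ` g"]) blast+
      then show False using ne by simp
    qed
    ultimately show ?thesis by auto
  qed
  \<comment> \<open>An edge contains its own copies of members of \<open>G\<close>, so equal
    \<open>\<psi>\<close> for distinct indices would contradict \<open>packed\<close>.\<close>
  have inj_psi: "inj_on \<psi> I"
  proof (rule inj_onI, rule ccontr)
    fix q q' assume *: "q \<in> I" "q' \<in> I" "\<psi> q = \<psi> q'" "q \<noteq> q'"
    obtain g where g: "g \<in> G" using G by blast
    then have "g \<subseteq> {1..k}" using G by (auto simp: nsets_def)
    then show False using packed[OF *(1,2,4)] g *(3) by (metis image_mono)
  qed
  have finK: "finite (K p)" for p
    by (rule finite_subset[of _ "C \<times> {..t} \<rightarrow>\<^sub>E {0..<int Q}"])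
      (use finC in \<open>auto simp: K_def labelled_code_def intro!: finite_PiE\<close>)
  have finI: "finite I"
    using finK finite_placements by (auto simp: I_def P_def)
  have "induced_packing k t G n (\<psi> ` I)"
    unfolding induced_packing_def
  proof (intro conjI ballI impI)
    fix \<psi>0 assume "\<psi>0 \<in> \<psi> ` I"
    then obtain q where q: "q \<in> I" "\<psi>0 = \<psi> q" by blast
    show "inj_on \<psi>0 {1..k}"
    proof (rule inj_onI)
      fix i j assume ij: "i \<in> {1..k}" "j \<in> {1..k}" "\<psi>0 i = \<psi>0 j"
      then have "fst (fst q) i = fst (fst q) j"
        using enc_eq[of "fst (fst q) i" "snd q" "fst (fst q) j" "snd q"] P P_I[OF q(1)] q(2) by (simp add: \<psi>_def)
      then show "i = j" using P_inj[OF P_I[OF q(1)]] ij by (meson inj_onD)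
    qed
    have "\<psi>0 j \<in> {1..n}" if "j \<in> {1..k}" for j
    proof -
      have "\<psi>0 j = enc (fst (fst q) j, w (snd q) (fst (fst q) j))" using that by (simp add: q \<psi>_def)
      then show ?thesis using enc(2) w_pts[OF P[OF P_I[OF q(1)] that]] by blast
    qed
    then show "\<psi>0 ` {1..k} \<subseteq> {1..n}" by blast
  qed (use packed in \<open>blast+\<close>)
  moreover have "card P * \<mu> * Q ^ (t * card C - 1) \<le> card I"
  proof -
    have "Q ^ (t * card C - 1) \<le> card (K p)" if p: "p \<in> P \<times> {..<\<mu>}" for p
    proof -
      \<comment> \<open>A \<open>t\<close>-subset of the image supplies the coordinate inside
        \<open>V\<close> whose leading coefficient absorbs the sum condition.\<close>
      let ?T = "fst p ` {1..t}"
      have T: "?T \<subseteq> fst p ` {1..k}" using t by auto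
      have "inj_on (fst p) {1..t}" using P_inj[of "fst p"] p t by (auto intro: inj_on_subset)
      then have "?T \<in> nsets {1..v} t"
        using p P[of "fst p"] t by (auto simp: nsets_def card_image)
      then have "(?T, 0) \<in> C" by (simp add: C_def)
      then show ?thesis unfolding K_def
      proof (rule card_labelled_code_ge[OF finC])
        show "coprime (\<Sum>x\<in>fst c. \<beta> x) (int Q)" if "c \<in> C" for c
        proof -
          have "fst c \<noteq> {}" using C_card[OF that] t by auto
          then show ?thesis using unit[of "fst c" "{}"] C_sub[OF that] by simp
        qed
      qed (use T t Qv in auto)
    qed
    then have "card (P \<times> {..<\<mu>}) * Q ^ (t * card C - 1) \<le> (\<Sum>p\<in>P \<times> {..<\<mu>}. card (K p))"
      using sum_bounded_below[of "P \<times> {..<\<mu>}"] by (metis of_nat_id)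
    also have "\<dots> = card I"
      unfolding I_def using finK finite_placements by (simp add: P_def)
    finally show ?thesis by (simp add: card_cartesian_product)
  qed
  ultimately show ?thesis
    using finI inj_psi by (intro exI[of _ "\<psi> ` I"]) (simp add: card_image P_def \<mu>_def)
qed

section \<open>Asymptotic density for all large \<open>n\<close>\<close>

text \<open>First \<open>v\<close> is fixed so large that \<open>v choose t\<close> is close to
  \<open>v ^ t / fact t\<close>; then the largest modulus of the progression with
  \<open>v * Q ^ d \<le> n\<close> is taken. Consecutive moduli differ by the constant
  \<open>L\<close>, so rounding \<open>n\<close> down costs only a factor tending to 1.\<close>

lemma induced_packing_of_density:
  assumes t: "1 \<le> t" "t \<le> k" and G: "G \<subseteq> nsets {1..k} t" "G \<noteq> {}" and \<delta>: "0 < \<delta>" "\<delta> < 1"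
  shows "\<exists>n0. \<forall>n\<ge>n0. \<exists>\<Psi>. finite \<Psi> \<and> induced_packing k t G n \<Psi> \<and>
     (1 - \<delta>) * real (n choose t) \<le> real (card G) * real (card \<Psi>)"
proof -
  \<comment> \<open>The ratio of \<open>v choose t\<close> to \<open>v ^ t / fact t\<close>.\<close>
  define \<alpha> where "\<alpha> v = (\<Prod>i<t. 1 - real i / real v)" for v
  have "\<alpha> \<longlonglongrightarrow> (\<Prod>i<t. 1 - 0)"
    unfolding \<alpha>_def by (intro tendsto_prod tendsto_diff tendsto_const lim_const_over_n)
  then have "\<forall>\<^sub>F v in sequentially. 1 - \<delta> < \<alpha> v"
    using \<delta> by (intro order_tendstoD) auto
  moreover have "\<forall>\<^sub>F v in sequentially. max k 1 \<le> v" by (rule eventually_ge_at_top)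
  ultimately have "\<forall>\<^sub>F v in sequentially. 1 - \<delta> < \<alpha> v \<and> max k 1 \<le> v" by (rule eventually_conj)
  then obtain v where v: "1 - \<delta> < \<alpha> v" "k \<le> v" "1 \<le> v"
    by (auto simp: eventually_sequentially)
  have choose_v: "real (v choose t) = \<alpha> v * real v ^ t / fact t"
  proof -
    have "real (v choose t) = (\<Prod>i<t. real v - real i) / fact t"
      by (simp add: binomial_gbinomial gbinomial_prod_rev atLeast0LessThan)
    also have "(\<Prod>i<t. real v - real i) = (\<Prod>i<t. (1 - real i / real v) * real v)"
      using v by (intro prod.cong) (auto simp: field_simps)
    also have "\<dots> = \<alpha> v * real v ^ t" by (simp add: \<alpha>_def prod.distrib)
    finally show ?thesis .
  qed
  obtain L and \<beta> :: "nat \<Rightarrow> int" where L: "L > 0" "\<forall>j.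
     (\<forall>X T. X \<subseteq> {1..v} \<longrightarrow> T \<subseteq> {1..v} \<longrightarrow> \<not> X \<subseteq> T \<longrightarrow>
       coprime (\<Sum>x\<in>X. \<beta> x * (\<Prod>y\<in>T. int x - int y)) (int (1 + L * j))) \<and>
     (\<forall>x\<in>{1..v}. \<forall>y\<in>{1..v}. x \<noteq> y \<longrightarrow> coprime (int x - int y) (int (1 + L * j)))"
    using modulus_with_units[of v] by (elim exE conjE)
  obtain m where m: "0 < m"
    "\<forall>T\<in>nsets {1..v} t. card {\<phi> \<in> placements k v. T \<in> (`) \<phi> ` G} = m"
    "card (placements k v) * card G = m * (v choose t)"
    using card_placements_through[OF G t(2) v(2)] by (elim exE conjE)
  define d where "d = card (nsets {1..v} t \<times> {0::nat} \<union> nsets {1..v} (Suc t) \<times> {..k})"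
  have "d > 0"
  proof -
    have "nsets {1..v} t \<noteq> {}" using t v by (auto simp: nsets_eq_empty_iff)
    then show ?thesis by (auto simp: d_def card_gt_0_iff finite_imp_finite_nsets)
  qed
  define Q where "Q j = 1 + L * j" for j
  have Q_top: "filterlim (\<lambda>j. real (Q j)) at_top sequentially"
    unfolding filterlim_at_top
  proof
    fix Z :: real
    have "Z \<le> real (Q j)" if "nat \<lceil>Z\<rceil> \<le> j" for j
    proof -
      have "Z \<le> real j" using that by linarith
      moreover have "j \<le> Q j" using L(1) by (simp add: Q_def le_SucI)
      ultimately show ?thesis by linarith
    qed
    then show "\<forall>\<^sub>F j in sequentially. Z \<le> real (Q j)"
      using eventually_sequentially by blast
  qed
  \<comment> \<open>The first factor is the cost of rounding \<open>n\<close> down to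
    \<open>v * Q j ^ d\<close>; the second accounts for the reserved label 0 and the floor in
    \<open>(Q j - 1) div m\<close>.\<close>
  define h where "h j = (1 / (1 + real L / real (Q j))) ^ (t * d) * (1 - (1 + real m) / real (Q j))" for j
  have "(\<lambda>j. \<alpha> v * h j) \<longlonglongrightarrow> \<alpha> v * ((1 / (1 + 0)) ^ (t * d) * (1 - 0))"
    unfolding h_def
    by (intro tendsto_intros tendsto_divide_0[OF tendsto_const] filterlim_at_top_imp_at_infinity Q_top) auto
  then have "\<forall>\<^sub>F j in sequentially. 1 - \<delta> < \<alpha> v * h j"
    using v by (intro order_tendstoD) auto
  then obtain j0 where j0: "\<And>j. j \<ge> j0 \<Longrightarrow> 1 - \<delta> < \<alpha> v * h j"
    by (auto simp: eventually_sequentially)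
  show ?thesis
  \<comment> \<open>This threshold makes the greatest admissible \<open>j\<close> at least
    \<open>j0\<close>, for the density, and at least \<open>v\<close>, for
    \<open>v < q\<close>.\<close>
  proof (intro exI[of _ "v * Q (max j0 v) ^ d"] allI impI)
    fix n assume n: "v * Q (max j0 v) ^ d \<le> n"
    have "j \<le> n" if "v * Q j ^ d \<le> n" for j
    proof -
      have "j \<le> Q j" using L(1) by (simp add: Q_def le_SucI)
      also have "\<dots> \<le> Q j ^ d" using \<open>d > 0\<close> by (intro self_le_power) (auto simp: Q_def)
      also have "\<dots> \<le> v * Q j ^ d" using v by simp
      finally show ?thesis using that by simp
    qed
    then have "\<exists>j. v * Q j ^ d \<le> n \<and> (\<forall>i. v * Q i ^ d \<le> n \<longrightarrow> i \<le> j)"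
      by (intro ex_has_greatest_nat[of "\<lambda>j. v * Q j ^ d \<le> n" _ "\<lambda>j. j" "Suc n", OF n])
        (simp add: less_Suc_eq_le)
    then obtain j where j: "v * Q j ^ d \<le> n" "\<forall>i. v * Q i ^ d \<le> n \<longrightarrow> i \<le> j"
      by (elim exE conjE)
    have j_ge: "j0 \<le> j" "v \<le> j" using j(2) n by auto
    define q where "q = Q j"
    have "v < q" using j_ge L(1) by (simp add: q_def Q_def less_Suc_eq_le le_trans)
    have "\<exists>\<Psi>. finite \<Psi> \<and> induced_packing k t G n \<Psi> \<and>
      card (placements k v) * ((q - 1) div m) * q ^ (t * d - 1) \<le> card \<Psi>"
      unfolding d_def
    proof (rule code_packing[OF t v(2) \<open>v < q\<close> G _ _ m(1)])
      show "coprime (\<Sum>x\<in>X. \<beta> x * (\<Prod>y\<in>T. int x - int y)) (int q)"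
        if "X \<subseteq> {1..v}" "T \<subseteq> {1..v}" "\<not> X \<subseteq> T" for X T
        using L(2) that unfolding q_def Q_def by simp
      show "coprime (int x - int y) (int q)" if "x \<in> {1..v}" "y \<in> {1..v}" "x \<noteq> y" for x y
        using L(2) that unfolding q_def Q_def by simp
      show "card {\<phi> \<in> placements k v. T \<in> (`) \<phi> ` G} = m" if "T \<in> nsets {1..v} t" for T
        using m(2) that by simp
      show "v * q ^ card (nsets {1..v} t \<times> {0::nat} \<union> nsets {1..v} (Suc t) \<times> {..k}) \<le> n"
        using j(1) unfolding q_def d_def .
    qed
    then obtain \<Psi> where \<Psi>: "finite \<Psi>" "induced_packing k t G n \<Psi>"
      "card (placements k v) * ((q - 1) div m) * q ^ (t * d - 1) \<le> card \<Psi>"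
      by blast
    \<comment> \<open>By maximality of \<open>j\<close> the next modulus \<open>q + L\<close> is
      already too large for \<open>n\<close>.\<close>
    have n_less: "n < v * (q + L) ^ d"
    proof (rule ccontr)
      assume "\<not> n < v * (q + L) ^ d"
      moreover have "q + L = Q (Suc j)" by (simp add: q_def Q_def)
      ultimately have "Suc j \<le> j" using j(2) by simp
      then show False by simp
    qed
    define D where "D = real v ^ t * real (q + L) ^ (t * d) / fact t"
    have "real (n choose t) \<le> D"
    proof -
      have "real (n choose t) * fact t \<le> real n ^ t"
        using binomial_fact_pow[of n t] by (metis of_nat_fact of_nat_le_iff of_nat_mult of_nat_power)
      also have "\<dots> \<le> (real v * real (q + L) ^ d) ^ t"
        using n_less by (intro power_mono) (auto simp flip: of_nat_mult of_nat_power of_nat_add)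
      also have "\<dots> = real v ^ t * real (q + L) ^ (t * d)"
        by (simp add: power_mult_distrib power_mult mult.commute flip: power_mult)
      finally show ?thesis by (simp add: D_def field_simps)
    qed
    then have "(1 - \<delta>) * real (n choose t) \<le> (1 - \<delta>) * D"
      using \<delta> by (intro mult_left_mono) auto
    also have "\<dots> \<le> \<alpha> v * h j * D"
      using j0[OF j_ge(1)] by (intro mult_right_mono) (auto simp: D_def)
    also have "\<dots> = real (v choose t) * (real q - 1 - real m) * real q ^ (t * d - 1)"
    proof -
      have q0: "real q > 0" using \<open>v < q\<close> by simp
      have "1 / (1 + real L / real q) = real q / real (q + L)"
        using q0 by (simp add: field_simps)
      then have h: "h j = (real q / real (q + L)) ^ (t * d) * (1 - (1 + real m) / real q)"
        by (simp add: h_def q_def)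
      have "h j * real (q + L) ^ (t * d) = real q ^ (t * d) * (1 - (1 + real m) / real q)"
        using q0 by (simp add: h power_divide)
      also have "real q ^ (t * d) = real q * real q ^ (t * d - 1)"
        using t \<open>d > 0\<close> by (simp flip: power_Suc)
      also have "real q * real q ^ (t * d - 1) * (1 - (1 + real m) / real q)
          = (real q - 1 - real m) * real q ^ (t * d - 1)"
        using q0 by (simp add: field_simps)
      finally have scaled: "h j * real (q + L) ^ (t * d) = (real q - 1 - real m) * real q ^ (t * d - 1)" .
      have "\<alpha> v * h j * D = real (v choose t) * (h j * real (q + L) ^ (t * d))"
        by (simp add: D_def choose_v)
      then show ?thesis unfolding scaled by (simp only: mult.assoc)
    qed
    also have "\<dots> \<le> real (v choose t) * (real m * real ((q - 1) div m)) * real q ^ (t * d - 1)"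
    proof -
      have "q - 1 < m + m * ((q - 1) div m)"
        using m(1) by (metis add.commute dividend_less_times_div)
      then have "real q - 1 - real m \<le> real m * real ((q - 1) div m)"
        using \<open>v < q\<close> by (simp flip: of_nat_mult)
      then show ?thesis by (intro mult_right_mono mult_left_mono) auto
    qed
    also have "\<dots> = real (m * (v choose t)) * real ((q - 1) div m) * real q ^ (t * d - 1)" by simp
    \<comment> \<open>The double count trades \<open>m * (v choose t)\<close> for the number of
      placements times \<open>card G\<close>.\<close>
    also have "\<dots> = real (card G) * real (card (placements k v) * ((q - 1) div m) * q ^ (t * d - 1))"
      unfolding m(3)[symmetric] by simp
    also have "\<dots> \<le> real (card G) * real (card \<Psi>)"
      using \<Psi>(3) by (intro mult_left_mono) (simp_all only: of_nat_le_iff of_nat_0_le_iff)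
    finally show "\<exists>\<Psi>. finite \<Psi> \<and> induced_packing k t G n \<Psi> \<and>
       (1 - \<delta>) * real (n choose t) \<le> real (card G) * real (card \<Psi>)"
      using \<Psi>(1,2) by blast
  qed
qed

section \<open>Frameproof hypergraphs from packings\<close>

text \<open>After thinning, every point lies in exactly \<open>s\<close> of the \<open>c\<close>
  sets. Hence \<open>s + 1\<close> of them have no common point, and \<open>c - s + 1\<close> of
  them cannot all miss a point. Counting incidences yields at least \<open>l\<close> sets of full
  size \<open>t\<close>.\<close>

lemma disjoint_subsequence:
  fixes D :: "nat \<Rightarrow> nat set"
  assumes "s \<le> c" "1 \<le> t" and sk: "s * k = (t - 1) * c + l"
    and D_sub: "\<And>j. j \<in> {1..c} \<Longrightarrow> D j \<subseteq> {1..k}"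
    and D_card: "\<And>j. j \<in> {1..c} \<Longrightarrow> card (D j) \<le> t"
    and cover: "\<And>i. i \<in> {1..k} \<Longrightarrow> s \<le> card {j \<in> {1..c}. i \<in> D j}"
  shows "\<exists>h. (\<forall>i\<in>{1..l}. h i \<in> {1..c} \<and> card (D (h i)) = t) \<and>
    disjoint_seq k l (s + 1) (c - s + 1) (\<lambda>i. D (h i))"
proof -
  have "\<exists>R. R \<subseteq> {j \<in> {1..c}. i \<in> D j} \<and> card R = s" if "i \<in> {1..k}" for i
    using obtain_subset_with_card_n[OF cover[OF that]] by blast
  then obtain R where R: "\<And>i. i \<in> {1..k} \<Longrightarrow> R i \<subseteq> {j \<in> {1..c}. i \<in> D j} \<and> card (R i) = s"
    by metis
  define D' where "D' j = {i \<in> {1..k}. j \<in> R i}" for j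
  have D'_sub: "D' j \<subseteq> D j" for j using R by (fastforce simp: D'_def)
  have fin_D: "finite (D j)" if "j \<in> {1..c}" for j
    using D_sub[OF that] finite_subset by blast
  have D'_card: "card (D' j) \<le> t" if "j \<in> {1..c}" for j
    using card_mono[OF fin_D[OF that] D'_sub] D_card[OF that] by simp
  define J where "J = {j \<in> {1..c}. card (D' j) = t}"
  \<comment> \<open>A thinned set of size \<open>t\<close> has lost nothing, since
    \<open>D j\<close> has at most \<open>t\<close> elements.\<close>
  have D'_eq: "D' j = D j" if "j \<in> J" for j
    using that D_card[of j] fin_D[of j] D'_sub[of j] by (intro card_seteq) (auto simp: J_def)
  have "(\<Sum>j\<in>{1..c}. card (D' j)) = s * card {1..k}"
    unfolding D'_def
  proof (rule sum_multicount)
    show "\<forall>i\<in>{1..k}. card {j \<in> {1..c}. j \<in> R i} = s"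
    proof
      fix i assume i: "i \<in> {1..k}"
      then have "{j \<in> {1..c}. j \<in> R i} = R i" using R by blast
      then show "card {j \<in> {1..c}. j \<in> R i} = s" using R[OF i] by simp
    qed
  qed simp_all
  \<comment> \<open>Thinned sets outside \<open>J\<close> have at most \<open>t - 1\<close>
    elements, so a total of \<open>(t - 1) * c + l\<close> forces
    \<open>l \<le> card J\<close>.\<close>
  moreover have "(\<Sum>j\<in>{1..c}. card (D' j)) \<le> (\<Sum>j\<in>{1..c}. (t - 1) + (if j \<in> J then 1 else 0))"
  proof (rule sum_mono)
    fix j assume j: "j \<in> {1..c}"
    show "card (D' j) \<le> (t - 1) + (if j \<in> J then 1 else 0)"
      using D'_card[OF j] j by (auto simp: J_def)
  qed
  moreover have "(\<Sum>j\<in>{1..c}. (t - 1) + (if j \<in> J then 1 else 0)) = (t - 1) * c + card J"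
  proof -
    have "(\<Sum>j\<in>{1..c}. if j \<in> J then 1 else 0 :: nat) = card ({1..c} \<inter> J)"
      by (simp flip: sum.inter_restrict)
    also have "{1..c} \<inter> J = J" by (auto simp: J_def)
    finally show ?thesis by (simp add: sum.distrib)
  qed
  ultimately have "l \<le> card J" using sk by simp
  then obtain h where h: "h ` {1..l} \<subseteq> J" "inj_on h {1..l}"
    using card_le_inj[of "{1..l}" J] by (auto simp: J_def)
  have h_J: "h i \<in> J" if "i \<in> {1..l}" for i using h that by blast
  have eq: "D (h i) = D' (h i)" if "i \<in> {1..l}" for i using D'_eq[OF h_J[OF that]] by simp
  have J_sub: "J \<subseteq> {1..c}" by (auto simp: J_def)
  have card_h: "card (h ` B) = card B" "h ` B \<subseteq> {1..c}" if "B \<subseteq> {1..l}" for B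
  proof -
    show "card (h ` B) = card B" using inj_on_subset[OF h(2) that] by (rule card_image)
    show "h ` B \<subseteq> {1..c}" using h(1) J_sub that by blast
  qed
  have fin_R: "finite (R i)" "card (R i) = s" "R i \<subseteq> {1..c}" if "i \<in> {1..k}" for i
    using R[OF that] by (auto intro: finite_subset)
  have "disjoint_seq k l (s + 1) (c - s + 1) (\<lambda>i. D (h i))"
    unfolding disjoint_seq_def
  proof (intro conjI ballI)
    fix i assume "i \<in> {1..l}"
    then show "D (h i) \<subseteq> {1..k}" using h_J J_sub D_sub by blast
  next
    fix B assume B: "B \<in> nsets {1..l} (s + 1)"
    have B_sub: "B \<subseteq> {1..l}" and B_card: "card B = s + 1" using B by (auto simp: nsets_def)
    show "(\<Inter>i\<in>B. D (h i)) = {}"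
    proof (rule ccontr)
      assume "(\<Inter>i\<in>B. D (h i)) \<noteq> {}"
      then obtain x where x: "\<And>i. i \<in> B \<Longrightarrow> x \<in> D' (h i)" using eq B_sub by blast
      have "B \<noteq> {}" using B_card by auto
      then have xk: "x \<in> {1..k}" using x by (auto simp: D'_def)
      have "h ` B \<subseteq> R x" using x by (auto simp: D'_def)
      then have "card (h ` B) \<le> s" using card_mono[OF fin_R(1)[OF xk]] fin_R(2)[OF xk] by metis
      then show False using card_h(1)[OF B_sub] B_card by simp
    qed
  next
    fix B assume B: "B \<in> nsets {1..l} (c - s + 1)"
    have B_sub: "B \<subseteq> {1..l}" and B_card: "card B = c - s + 1" using B by (auto simp: nsets_def)
    show "(\<Union>i\<in>B. D (h i)) = {1..k}"
    proof
      show "(\<Union>i\<in>B. D (h i)) \<subseteq> {1..k}" using eq B_sub by (auto simp: D'_def)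
      show "{1..k} \<subseteq> (\<Union>i\<in>B. D (h i))"
      proof (rule subsetI, rule ccontr)
        fix x assume x: "x \<in> {1..k}" and miss: "x \<notin> (\<Union>i\<in>B. D (h i))"
        have "h i \<notin> R x" if "i \<in> B" for i
        proof -
          have "x \<notin> D (h i)" using miss that by blast
          moreover have "D (h i) = D' (h i)" using eq that B_sub by blast
          ultimately show ?thesis using x by (simp add: D'_def)
        qed
        then have "h ` B \<subseteq> {1..c} - R x" using card_h(2)[OF B_sub] by blast
        then have "card (h ` B) \<le> card ({1..c} - R x)" by (intro card_mono) auto
        also have "\<dots> = c - s" using fin_R[OF x] by (simp add: card_Diff_subset)
        finally show False using card_h(1)[OF B_sub] B_card by simp
      qed
    qed
  qed
  moreover have "h i \<in> {1..c} \<and> card (D (h i)) = t" if "i \<in> {1..l}" for i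
    using h_J[OF that] D'_eq[OF h_J[OF that]] by (simp add: J_def)
  ultimately show ?thesis by blast
qed

text \<open>Traces on \<open>A0\<close> are pulled back along its injection to [k]. The packing
  bounds their size by \<open>t\<close>, and inducedness forces those of size \<open>t\<close> into
  \<open>F\<close>, where \<open>free\<close> forbids the resulting sequence.\<close>

lemma frameproof_of_induced_packing:
  assumes "s \<le> c" "1 \<le> t" and sk: "s * k = (t - 1) * c + l"
    and free: "\<nexists>A. (\<forall>i\<in>{1..l}. A i \<in> F) \<and> disjoint_seq k l (s + 1) (c - s + 1) A"
    and pack: "induced_packing k t (nsets {1..k} t - F) n \<Psi>"
  shows "frameproof c s ((\<lambda>\<psi>. \<psi> ` {1..k}) ` \<Psi>)"
  unfolding frameproof_def
proof (intro ballI allI impI, rule ccontr)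
  fix A0 and A :: "nat \<Rightarrow> nat set"
  assume A0: "A0 \<in> (\<lambda>\<psi>. \<psi> ` {1..k}) ` \<Psi>"
    and A: "\<forall>j\<in>{1..c}. A j \<in> (\<lambda>\<psi>. \<psi> ` {1..k}) ` \<Psi> \<and> A0 \<noteq> A j"
    and bad: "\<not> (\<exists>i\<in>A0. card {j \<in> {1..c}. i \<in> A j} < s)"
  obtain \<psi> where \<psi>: "\<psi> \<in> \<Psi>" "A0 = \<psi> ` {1..k}" using A0 by blast
  have inj: "inj_on \<psi> {1..k}" using pack \<psi> by (simp add: induced_packing_def)
  define D where "D j = {i \<in> {1..k}. \<psi> i \<in> A j}" for j
  have D_sub: "D j \<subseteq> {1..k}" for j by (auto simp: D_def)
  then have D_fin: "finite (D j)" for j by (rule finite_subset) simp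
  have img: "\<psi> ` D j \<subseteq> A0 \<inter> A j" for j using \<psi> by (auto simp: D_def)
  have D_small: "card (D j) \<le> t" and D_F: "card (D j) = t \<Longrightarrow> D j \<in> F" if j: "j \<in> {1..c}" for j
  proof -
    obtain \<psi>' where \<psi>': "\<psi>' \<in> \<Psi>" "A j = \<psi>' ` {1..k}" "\<psi> \<noteq> \<psi>'"
      using A j \<psi> by blast
    then have meet: "card (A0 \<inter> A j) \<le> t" and ind: "\<forall>g\<in>nsets {1..k} t - F. \<not> \<psi> ` g \<subseteq> A j"
      using pack \<psi> by (simp_all add: induced_packing_def)
    have "card (D j) = card (\<psi> ` D j)"
      using inj by (intro card_image[symmetric] inj_on_subset[OF inj]) (auto simp: D_def)
    also have "\<dots> \<le> card (A0 \<inter> A j)" using img \<psi> by (intro card_mono) auto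
    finally show "card (D j) \<le> t" using meet by simp
    show "D j \<in> F" if "card (D j) = t"
    proof (rule ccontr)
      assume "D j \<notin> F"
      then have "D j \<in> nsets {1..k} t - F" using that D_sub D_fin by (simp add: nsets_def)
      then show False using ind img[of j] by blast
    qed
  qed
  have cover: "s \<le> card {j \<in> {1..c}. i \<in> D j}" if i: "i \<in> {1..k}" for i
  proof -
    have "s \<le> card {j \<in> {1..c}. \<psi> i \<in> A j}" using bad i \<psi> by (simp add: not_less)
    also have "{j \<in> {1..c}. \<psi> i \<in> A j} = {j \<in> {1..c}. i \<in> D j}" using i by (simp add: D_def)
    finally show ?thesis .
  qed
  obtain h where h: "\<forall>i\<in>{1..l}. h i \<in> {1..c} \<and> card (D (h i)) = t"
      "disjoint_seq k l (s + 1) (c - s + 1) (\<lambda>i. D (h i))"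
    using disjoint_subsequence[OF assms(1,2) sk D_sub D_small cover] by blast
  have "\<forall>i\<in>{1..l}. D (h i) \<in> F" using h(1) D_F by simp
  then have "\<exists>A. (\<forall>i\<in>{1..l}. A i \<in> F) \<and> disjoint_seq k l (s + 1) (c - s + 1) A"
    using h(2) by (intro exI[of _ "\<lambda>i. D (h i)"] conjI)
  then show False using free by contradiction
qed

section \<open>The extremal numbers and the arithmetic of \<open>t\<close> and
  \<open>l\<close>\<close>

lemma card_le_max_frameproof:
  assumes "F \<subseteq> nsets {1..n} k" "frameproof c s F"
  shows "card F \<le> max_frameproof c s n k"
  unfolding max_frameproof_def
proof (rule Max_ge)
  have "{card F | F. F \<subseteq> nsets {1..n} k \<and> frameproof c s F} \<subseteq> card ` Pow (nsets {1..n} k)" by blast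
  then show "finite {card F | F. F \<subseteq> nsets {1..n} k \<and> frameproof c s F}"
    by (rule finite_subset) (simp add: finite_imp_finite_nsets)
qed (use assms in blast)

text \<open>One member of the complement of \<open>F\<close> already shows that distinct injections
  of the packing have distinct images, so no edges are lost in passing to the hypergraph.\<close>

lemma card_le_max_frameproof_of_induced_packing:
  assumes "s \<le> c" "1 \<le> t" "s * k = (t - 1) * c + l"
    and "\<nexists>A. (\<forall>i\<in>{1..l}. A i \<in> F) \<and> disjoint_seq k l (s + 1) (c - s + 1) A"
    and ne: "nsets {1..k} t - F \<noteq> {}"
    and pack: "induced_packing k t (nsets {1..k} t - F) n \<Psi>"
  shows "card \<Psi> \<le> max_frameproof c s n k"
proof -
  let ?f = "\<lambda>\<psi>. \<psi> ` {1..k}"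
  obtain g where g: "g \<in> nsets {1..k} t - F" using ne by blast
  then have gk: "g \<subseteq> {1..k}" by (auto simp: nsets_def)
  have "inj_on ?f \<Psi>"
  proof (rule inj_onI, rule ccontr)
    fix \<psi> \<psi>' :: "nat \<Rightarrow> nat"
    assume *: "\<psi> \<in> \<Psi>" "\<psi>' \<in> \<Psi>" "?f \<psi> = ?f \<psi>'" "\<psi> \<noteq> \<psi>'"
    have "\<not> \<psi> ` g \<subseteq> \<psi>' ` {1..k}" using pack * g by (simp add: induced_packing_def)
    then show False using *(3) gk by (metis image_mono)
  qed
  then have "card \<Psi> = card (?f ` \<Psi>)" by (simp add: card_image)
  also have "\<dots> \<le> max_frameproof c s n k"
  proof (rule card_le_max_frameproof)
    show "?f ` \<Psi> \<subseteq> nsets {1..n} k"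
      using pack by (auto simp: induced_packing_def nsets_def card_image)
    show "frameproof c s (?f ` \<Psi>)"
      using assms by (intro frameproof_of_induced_packing)
  qed
  finally show ?thesis .
qed

text \<open>\<open>1 \<le> l\<close> makes the empty family admissible, so the maximum ranges over a
  nonempty finite set.\<close>

lemma max_disjoint_free_attained:
  assumes "1 \<le> l"
  shows "\<exists>F. F \<subseteq> nsets {1..k} t \<and> card F = max_disjoint_free k t l k1 k2 \<and>
    (\<nexists>A. (\<forall>i\<in>{1..l}. A i \<in> F) \<and> disjoint_seq k l k1 k2 A)"
proof -
  let ?S = "{card F | F. F \<subseteq> nsets {1..k} t \<and>
    \<not> (\<exists>A. (\<forall>i\<in>{1..l}. A i \<in> F) \<and> disjoint_seq k l k1 k2 A)}"
  have "?S \<subseteq> card ` Pow (nsets {1..k} t)" by blast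
  then have "finite ?S" by (rule finite_subset) (simp add: finite_imp_finite_nsets)
  moreover have "?S \<noteq> {}" using assms by (auto intro!: exI[of _ "{}"])
  ultimately have "Max ?S \<in> ?S" by (rule Max_in)
  then show ?thesis unfolding max_disjoint_free_def by (elim CollectE exE conjE) metis
qed

text \<open>The ceiling leaves a remainder in 1 to \<open>c\<close> rather than 0 to
  \<open>c - 1\<close>; if \<open>c\<close> divides \<open>s * k\<close>, then
  \<open>l = c\<close>.\<close>

lemma ceiling_div_residue:
  fixes k c s t l :: nat
  assumes "1 \<le> s * k" "1 \<le> c" and t: "t = nat \<lceil>real (s * k) / real c\<rceil>"
    and l: "l \<in> {1..c}" "[l = s * k] (mod c)"
  shows "1 \<le> t" "s * k = (t - 1) * c + l"
proof -
  have "0 < real (s * k) / real c" using assms(1,2) by simp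
  then have pos: "0 < \<lceil>real (s * k) / real c\<rceil>" by simp
  then show t1: "1 \<le> t" using t by linarith
  have "real t = of_int \<lceil>real (s * k) / real c\<rceil>" using pos t by linarith
  then have "real t - 1 < real (s * k) / real c" "real (s * k) / real c \<le> real t"
    by linarith+
  then have "(real t - 1) * real c < real (s * k)" "real (s * k) \<le> real t * real c"
    using assms(2) by (simp_all add: field_simps)
  moreover have "real ((t - 1) * c) = (real t - 1) * real c" using t1 by (simp add: of_nat_diff)
  ultimately have "real ((t - 1) * c) < real (s * k)" "real (s * k) \<le> real (t * c)"
    by (simp_all only: of_nat_mult)
  then have lo: "(t - 1) * c < s * k" and hi: "s * k \<le> t * c"
    by (simp_all only: of_nat_less_iff of_nat_le_iff)
  define r where "r = s * k - (t - 1) * c"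
  have sk: "s * k = (t - 1) * c + r" using lo by (simp add: r_def)
  have r: "1 \<le> r" "r \<le> c"
    using lo hi t1 by (auto simp: r_def diff_mult_distrib)
  have "[l = r] (mod c)" using l(2) unfolding sk by (simp add: cong_def)
  \<comment> \<open>Shifting by one moves both residues below \<open>c\<close>, where congruence is
    equality.\<close>
  then have "[l - 1 = r - 1] (mod c)" using l(1) r by (simp add: cong_diff_nat)
  then have "l - 1 = r - 1" using l(1) r by (auto simp: cong_def)
  moreover have "1 \<le> l" using l(1) by simp
  ultimately have "l = r" using r(1) by linarith
  then show "s * k = (t - 1) * c + l" using sk by simp
qed

section \<open>The asymptotic lower bound\<close>

theorem theorem2p4:
  fixes k c s t l :: nat
  assumes "k \<ge> 2" and "c \<ge> 2" and "1 \<le> s" and "s \<le> c - 1"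
    and "t = nat \<lceil>real (s * k) / real c\<rceil>"
    and "l \<in> {1..c}" and "[l = s * k] (mod c)"
  shows "\<exists>\<epsilon> :: nat \<Rightarrow> real. \<epsilon> \<longlonglongrightarrow> 0 \<and>
    (\<forall>n. real (max_frameproof c s n k) \<ge>
       (1 - \<epsilon> n) * (real (n choose t) /
         (real (k choose t) - real (max_disjoint_free k t l (s + 1) (c - s + 1)))))"
proof -
  have sk_pos: "1 \<le> s * k" using assms(1,3) by (simp add: Suc_le_eq)
  have c1: "1 \<le> c" and sc: "s \<le> c" using assms(2,4) by auto
  have t1: "1 \<le> t" and sk: "s * k = (t - 1) * c + l"
    using ceiling_div_residue[OF sk_pos c1 assms(5-7)] by auto
  have "(t - 1) * c < k * c"
  proof -
    have "(t - 1) * c < s * k" using sk assms(6) by simp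
    also have "\<dots> \<le> k * c" using sc by simp
    finally show ?thesis .
  qed
  then have tk: "t \<le> k" by simp linarith
  have l1: "1 \<le> l" using assms(6) by simp
  obtain F where F: "F \<subseteq> nsets {1..k} t" "card F = max_disjoint_free k t l (s + 1) (c - s + 1)"
    and free: "\<nexists>A. (\<forall>i\<in>{1..l}. A i \<in> F) \<and> disjoint_seq k l (s + 1) (c - s + 1) A"
    using max_disjoint_free_attained[OF l1, of k t "s + 1" "c - s + 1"] by (elim exE conjE)
  define G where "G = nsets {1..k} t - F"
  have G_sub: "G \<subseteq> nsets {1..k} t" by (simp add: G_def)
  have fin: "finite (nsets {1..k} t)" by (simp add: finite_imp_finite_nsets)
  have "card G = card (nsets {1..k} t) - card F"
    unfolding G_def by (rule card_Diff_subset[OF finite_subset[OF F(1) fin] F(1)])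
  moreover have "card F \<le> card (nsets {1..k} t)" by (rule card_mono[OF fin F(1)])
  ultimately have card_G: "real (k choose t) - real (max_disjoint_free k t l (s + 1) (c - s + 1)) = real (card G)"
    using F(2) by (simp add: of_nat_diff)
  define f where "f n = real (max_frameproof c s n k)" for n
  define R where "R n = real (n choose t) / real (card G)" for n
  have R_nonneg: "0 \<le> R n" for n by (simp add: R_def)
  \<comment> \<open>The least nonnegative error for which the bound holds when \<open>R n\<close> is
    nonzero; it is 0 when \<open>R n = 0\<close>, where the bound is trivial.\<close>
  define \<epsilon> where "\<epsilon> n = (if R n = 0 then 0 else max 0 (1 - f n / R n))" for n
  have bound: "(1 - \<epsilon> n) * R n \<le> f n" for n
  proof (cases "R n = 0")
    case False
    then have "0 < R n" using R_nonneg[of n] by simp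
    moreover have "1 - \<epsilon> n \<le> f n / R n" using False by (simp add: \<epsilon>_def)
    ultimately show ?thesis by (simp add: pos_le_divide_eq)
  qed (simp add: f_def)
  have "\<exists>n0. \<forall>n\<ge>n0. \<bar>\<epsilon> n\<bar> < e" if e: "0 < e" for e
  proof (cases "G = {}")
    \<comment> \<open>Here the denominator \<open>card G\<close> is 0 and division by zero gives 0,
      so \<open>R\<close> and \<open>\<epsilon>\<close> vanish identically.\<close>
    case True
    then show ?thesis using e by (simp add: \<epsilon>_def R_def)
  next
    case False
    \<comment> \<open>Halving keeps \<open>\<delta>\<close> strictly below both \<open>e\<close> and
      1.\<close>
    define \<delta> where "\<delta> = min e 1 / 2"
    have \<delta>: "0 < \<delta>" "\<delta> < 1" "\<delta> < e" using e by (auto simp: \<delta>_def)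
    have gpos: "0 < real (card G)"
      using False finite_subset[OF G_sub fin] by (simp add: card_gt_0_iff)
    obtain n0 where n0: "\<And>n. n \<ge> n0 \<Longrightarrow> \<exists>\<Psi>. finite \<Psi> \<and> induced_packing k t G n \<Psi> \<and>
        (1 - \<delta>) * real (n choose t) \<le> real (card G) * real (card \<Psi>)"
      using induced_packing_of_density[OF t1 tk G_sub False \<delta>(1,2)] by blast
    have "\<bar>\<epsilon> n\<bar> < e" if n: "n0 \<le> n" for n
    proof -
      obtain \<Psi> where \<Psi>: "induced_packing k t G n \<Psi>"
          "(1 - \<delta>) * real (n choose t) \<le> real (card G) * real (card \<Psi>)"
        using n0[OF n] by blast
      have "card \<Psi> \<le> max_frameproof c s n k"
        using card_le_max_frameproof_of_induced_packing[OF sc t1 sk free] \<Psi>(1) False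
        unfolding G_def by blast
      then have "real (card G) * real (card \<Psi>) \<le> real (card G) * f n"
        unfolding f_def by (intro mult_left_mono) auto
      with \<Psi>(2) have "(1 - \<delta>) * real (n choose t) \<le> real (card G) * f n" by (rule order_trans)
      then have "(1 - \<delta>) * R n \<le> f n"
        using gpos by (simp add: R_def pos_divide_le_eq mult.commute)
      then have "1 - f n / R n \<le> \<delta>" if "R n \<noteq> 0"
        using R_nonneg[of n] that by (simp add: field_simps)
      then show ?thesis using \<delta> e by (auto simp: \<epsilon>_def)
    qed
    then show ?thesis by blast
  qed
  then have "\<epsilon> \<longlonglongrightarrow> 0" by (intro LIMSEQ_I) simp
  then show ?thesis
    using bound unfolding card_G f_def R_def by blast
qed

end
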